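(* Let $\vartheta_{\mathbf P}=(\vartheta,\mathbf P)$ be a compatible, irreducible Pisot random substitution on $\mathcal A=\{1,\dots,d\}$ with Rauzy measures $(\overline\mu_a)_{a\in\mathcal A}$, and let $\nu$ be a $\vartheta_{\mathbf P}$-invariant probability measure on $X_\vartheta$. Then for $\nu$-almost every $w$, $$\mu_a(w):=\lim_{n\to\infty}\frac1n\,\mu_a(w_{[1,n]})=\overline\mu_a$$ in the sense of weak convergence, for all $a\in\mathcal A$.
   Context: Let $\mathcal A^+$ be the set of non-empty finite words over $\mathcal A$, $|u|$ the length of $u$, $|u|_i$ the number of occurrences of $i$ in $u$, $\psi(u)=(|u|_1,\dots,|u|_d)^T$, and $u_{[1,m]}=u_1\cdots u_m$ (empty if $m=0$; also for infinite sequences). A random substitution $\vartheta_{\mathbf P}=(\vartheta,\mathbf P)$ is a map $\vartheta$ assigning to each letter $i$ a non-empty finite set $\vartheta(i)\subset\mathcal A^+$ together with probability vectors $p_i\colon\vartheta(i)\to(0,1]$, $\sum_{v\in\vartheta(i)}p_i(v)=1$. For a word $u=u_1\cdots u_n$, $\vartheta_{\mathbf P}(u)$ is the random word obtained by independently replacing each letter $u_k$ by $v\in\vartheta(u_k)$ with probability $p_{u_k}(v)$ and concatenating in order; $(\vartheta_{\mathbf P}^n(u))_{n\ge0}$ is the Markov chain on $\mathcal A^+$ started at $u$ with these transition probabilities, with probability $\mathbb P$ and expectation $\mathbb E$; $\vartheta^n(u)$ is the set of words attained by $\vartheta_{\mathbf P}^n(u)$ with positive probability. It is compatible if $\psi(u)=\psi(v)$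 for all $a\in\mathcal A$, $u,v\in\vartheta(a)$; then all elements of $\vartheta^n(v)$ have a common length $|\vartheta^n(v)|$, and the substitution matrix is $M_{i,j}=|v|_i$ for any $v\in\vartheta(j)$. It is primitive if $M$ is primitive with Perron–Frobenius eigenvalue $\lambda>1$. A compatible primitive random substitution is irreducible Pisot if $\lambda$ is a Pisot number and the characteristic polynomial of $M$ is irreducible over $\mathbb Z$. The language $\mathcal L_\vartheta$ is the set of words that are subwords of some element of $\vartheta^k(a)$, $a\in\mathcal A$, $k\in\mathbb N$; $\mathcal L_\vartheta^n=\mathcal L_\vartheta\cap\mathcal A^n$; $X_\vartheta$ is the set of $x\in\mathcal A^{\mathbb N}$ all of whose finite subwords lie in $\mathcal L_\vartheta$. For $w\in\mathcal L_\vartheta$, $[w]=\{x\in X_\vartheta:x_{[1,|w|]}=w\}$. A probability measure $\nu$ on $X_\vartheta$ is $\vartheta_{\mathbf P}$-invariant if for all $w\in\mathcal L_\vartheta$, $\nu([w])=\sum_{v\in\mathcal L_\vartheta^{|w|}}\nu([v])\,\mathbb P[\vartheta_{\mathbf P}(v)_{[1,|w|]}=w]$. $\mathbf L,\mathbf R$ are left and right Perron–Frobenius eigenvectors of $M$ with $\|\mathbf R\|_1=1=\mathbf L^T\mathbf R$; $\mathbb H\subset\mathbb R^d$ is the hyperplane orthogonal to $\mathbf L$; $\pi$ is the linear projection along $\mathbf R$ onto $\mathbb H$. For a finite word $w$ and $a\in\mathcal A$, $\mu_a(w)=\sum_{0\le m\le|w|-1,\ w_{m+1}=a}\delta_{\pi(\psi(w_{[1,m]}))}$.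 The Rauzy measure $\overline\mu_a$ is the weak limit $\overline\mu_a=\lim_{n\to\infty}|\vartheta^n(v)|^{-1}\,\mathbb E[\mu_a(\vartheta_{\mathbf P}^n(v))]$, which exists and is the same for every $v\in\mathcal A^+$. *)

theory Defs
  imports
    "HOL-Probability.Probability"
    "HOL-Library.Sublist"
    "HOL-Computational_Algebra.Computational_Algebra"
begin

text \<open>The alphabet \<open>{1,\<dots>,d}\<close> is an arbitrary finite type \<open>'a\<close> (so \<open>d = CARD('a)\<close>), and \<open>\<real>\<^sup>d\<close>
  is \<open>real^'a\<close>. Words are lists; infinite sequences are functions \<open>nat \<Rightarrow> 'a\<close>, indexed from 0.\<close>

section \<open>Random substitutions\<close>

text \<open>A random substitution is a map \<open>\<theta> :: 'a \<Rightarrow> 'a list pmf\<close>: the finite set attached to the letter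
  \<open>i\<close> is \<open>set_pmf (\<theta> i)\<close>, on which the probability vector \<open>pmf (\<theta> i)\<close> is automatically positive.\<close>

definition random_substitution :: "('a \<Rightarrow> 'a list pmf) \<Rightarrow> bool" where
  "random_substitution \<theta> \<longleftrightarrow> (\<forall>i. finite (set_pmf (\<theta> i)) \<and> [] \<notin> set_pmf (\<theta> i))"

primrec subst_word :: "('a \<Rightarrow> 'a list pmf) \<Rightarrow> 'a list \<Rightarrow> 'a list pmf" where
  "subst_word \<theta> [] = return_pmf []"
| "subst_word \<theta> (i # u) =
     bind_pmf (\<theta> i) (\<lambda>v. bind_pmf (subst_word \<theta> u) (\<lambda>w. return_pmf (v @ w)))"

text \<open>The law at time \<open>n\<close> of the Markov chain started at \<open>u\<close>; its support is \<open>\<vartheta>\<^sup>n(u)\<close>.\<close>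

primrec subst_iter :: "('a \<Rightarrow> 'a list pmf) \<Rightarrow> nat \<Rightarrow> 'a list \<Rightarrow> 'a list pmf" where
  "subst_iter \<theta> 0 u = return_pmf u"
| "subst_iter \<theta> (Suc n) u = bind_pmf (subst_iter \<theta> n u) (subst_word \<theta>)"

definition abelianization :: "'a::finite list \<Rightarrow> real^'a" where
  "abelianization u = (\<chi> i. real (count_list u i))"

definition compatible :: "('a::finite \<Rightarrow> 'a list pmf) \<Rightarrow> bool" where
  "compatible \<theta> \<longleftrightarrow>
     (\<forall>a. \<forall>u\<in>set_pmf (\<theta> a). \<forall>v\<in>set_pmf (\<theta> a). abelianization u = abelianization v)"

text \<open>The common length of the elements of \<open>\<vartheta>\<^sup>n(v)\<close>, for compatible \<open>\<theta>\<close>.\<close>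

definition iter_length :: "('a \<Rightarrow> 'a list pmf) \<Rightarrow> nat \<Rightarrow> 'a list \<Rightarrow> nat" where
  "iter_length \<theta> n v = (THE l. \<forall>u\<in>set_pmf (subst_iter \<theta> n v). length u = l)"

text \<open>The substitution matrix is polymorphic in the coefficients, so that it can be read over
  \<open>int\<close>, \<open>real\<close> and \<open>complex\<close>. For compatible \<open>\<theta>\<close> the choice of the word is irrelevant.\<close>

definition subst_matrix :: "('a::finite \<Rightarrow> 'a list pmf) \<Rightarrow> 'r::semiring_1^'a^'a" where
  "subst_matrix \<theta> = (\<chi> i j. of_nat (count_list (SOME v. v \<in> set_pmf (\<theta> j)) i))"


section \<open>Primitive and irreducible Pisot substitutions\<close>

definition primitive_matrix :: "real^'n^'n \<Rightarrow> bool" where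
  "primitive_matrix A \<longleftrightarrow>
     (\<forall>i j. 0 \<le> A $ i $ j) \<and> (\<exists>k>0. \<forall>i j. 0 < (((**) A ^^ k) (mat 1)) $ i $ j)"

definition spectrum :: "complex^'n^'n \<Rightarrow> complex set" where
  "spectrum A = {z. \<exists>x. x \<noteq> 0 \<and> A *v x = z *s x}"

text \<open>The Perron--Frobenius eigenvalue of \<open>M\<close> is its spectral radius.\<close>

definition pf_eigenvalue :: "('a::finite \<Rightarrow> 'a list pmf) \<Rightarrow> real" where
  "pf_eigenvalue \<theta> = Max (cmod ` spectrum (subst_matrix \<theta>))"

definition primitive_subst :: "('a::finite \<Rightarrow> 'a list pmf) \<Rightarrow> bool" where
  "primitive_subst \<theta> \<longleftrightarrow> primitive_matrix (subst_matrix \<theta>) \<and> 1 < pf_eigenvalue \<theta>"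

definition charpoly :: "'r::comm_ring_1^'n^'n \<Rightarrow> 'r poly" where
  "charpoly A = det (mat [:0, 1:] - (\<chi> i j. [:A $ i $ j:]))"

text \<open>A real algebraic integer greater than 1 all of whose other Galois conjugates lie in the
  open unit disc; the polynomial \<open>p\<close> below is the minimal polynomial.\<close>

definition pisot_number :: "real \<Rightarrow> bool" where
  "pisot_number x \<longleftrightarrow> 1 < x \<and>
     (\<exists>p::int poly. lead_coeff p = 1 \<and> irreducible p \<and> poly (map_poly of_int p) x = 0 \<and>
        (\<forall>z::complex. poly (map_poly of_int p) z = 0 \<longrightarrow> z \<noteq> of_real x \<longrightarrow> cmod z < 1))"

definition irreducible_pisot :: "('a::finite \<Rightarrow> 'a list pmf) \<Rightarrow> bool" where
  "irreducible_pisot \<theta> \<longleftrightarrow> compatible \<theta> \<and> primitive_subst \<theta> \<and>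
     pisot_number (pf_eigenvalue \<theta>) \<and> irreducible (charpoly (subst_matrix \<theta> :: int^'a^'a))"


section \<open>The subshift and invariant measures\<close>

definition language :: "('a \<Rightarrow> 'a list pmf) \<Rightarrow> 'a list set" where
  "language \<theta> = {u. \<exists>a k. \<exists>v\<in>set_pmf (subst_iter \<theta> k [a]). sublist u v}"

definition prefix_seq :: "(nat \<Rightarrow> 'a) \<Rightarrow> nat \<Rightarrow> 'a list" where
  "prefix_seq x n = map x [0..<n]"

definition subshift :: "('a \<Rightarrow> 'a list pmf) \<Rightarrow> (nat \<Rightarrow> 'a) set" where
  "subshift \<theta> = {x. \<forall>m n. map x [m..<n] \<in> language \<theta>}"

definition subshift_space :: "('a \<Rightarrow> 'a list pmf) \<Rightarrow> (nat \<Rightarrow> 'a) measure" where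
  "subshift_space \<theta> = restrict_space (PiM UNIV (\<lambda>_. count_space UNIV)) (subshift \<theta>)"

definition cylinder :: "('a \<Rightarrow> 'a list pmf) \<Rightarrow> 'a list \<Rightarrow> (nat \<Rightarrow> 'a) set" where
  "cylinder \<theta> w = {x \<in> subshift \<theta>. prefix_seq x (length w) = w}"

definition invariant_measure :: "('a \<Rightarrow> 'a list pmf) \<Rightarrow> (nat \<Rightarrow> 'a) measure \<Rightarrow> bool" where
  "invariant_measure \<theta> \<nu> \<longleftrightarrow> sets \<nu> = sets (subshift_space \<theta>) \<and> prob_space \<nu> \<and>
     (\<forall>w\<in>language \<theta>. measure \<nu> (cylinder \<theta> w) =
        (\<Sum>v\<in>{v\<in>language \<theta>. length v = length w}. measure \<nu> (cylinder \<theta> v) *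
           measure_pmf.prob (subst_word \<theta> v) {u. take (length w) u = w}))"


section \<open>Rauzy measures\<close>

text \<open>Positive left and right eigenvectors \<open>L\<close>, \<open>R\<close> for the Perron--Frobenius eigenvalue, normalised
  by \<open>\<parallel>R\<parallel>\<^sub>1 = 1 = L\<^sup>T R\<close>; for primitive \<open>\<theta>\<close> they exist and are unique.\<close>

definition pf_eigenvectors :: "('a::finite \<Rightarrow> 'a list pmf) \<Rightarrow> real^'a \<Rightarrow> real^'a \<Rightarrow> bool" where
  "pf_eigenvectors \<theta> L R \<longleftrightarrow>
     L v* subst_matrix \<theta> = pf_eigenvalue \<theta> *\<^sub>R L \<and> (\<forall>i. 0 < L $ i) \<and>
     subst_matrix \<theta> *v R = pf_eigenvalue \<theta> *\<^sub>R R \<and> (\<forall>i. 0 < R $ i) \<and>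
     (\<Sum>i\<in>UNIV. \<bar>R $ i\<bar>) = 1 \<and> L \<bullet> R = 1"

definition pf_hyperplane :: "real^'a::finite \<Rightarrow> (real^'a) set" where
  "pf_hyperplane L = {x. L \<bullet> x = 0}"

definition pf_proj :: "real^'a::finite \<Rightarrow> real^'a \<Rightarrow> real^'a \<Rightarrow> real^'a" where
  "pf_proj L R x = x - (L \<bullet> x) *\<^sub>R R"

text \<open>When \<open>L \<bullet> R = 1\<close>, this is the linear projection along \<open>R\<close> onto the hyperplane.\<close>

lemma pf_proj_characterization:
  assumes "L \<bullet> R = 1"
  shows "linear \<pi> \<and> \<pi> R = 0 \<and> (\<forall>x\<in>pf_hyperplane L. \<pi> x = x) \<longleftrightarrow> \<pi> = pf_proj L R"
    and "range (pf_proj L R) = pf_hyperplane L"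
proof -
  have mem: "pf_proj L R x \<in> pf_hyperplane L" for x
    using assms by (simp add: pf_proj_def pf_hyperplane_def inner_diff_right)
  have fix': "pf_proj L R x = x" if "x \<in> pf_hyperplane L" for x
    using that by (simp add: pf_proj_def pf_hyperplane_def)
  have lin: "linear (pf_proj L R)"
    by (rule linearI) (simp_all add: pf_proj_def inner_add_right algebra_simps)
  have zero: "pf_proj L R R = 0"
    using assms by (simp add: pf_proj_def)
  show "linear \<pi> \<and> \<pi> R = 0 \<and> (\<forall>x\<in>pf_hyperplane L. \<pi> x = x) \<longleftrightarrow> \<pi> = pf_proj L R"
  proof
    assume *: "linear \<pi> \<and> \<pi> R = 0 \<and> (\<forall>x\<in>pf_hyperplane L. \<pi> x = x)"
    have "\<pi> x = pf_proj L R x" for x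
    proof -
      have "\<pi> x = \<pi> (pf_proj L R x + (L \<bullet> x) *\<^sub>R R)"
        by (simp add: pf_proj_def)
      also have "\<dots> = \<pi> (pf_proj L R x) + (L \<bullet> x) *\<^sub>R \<pi> R"
        using * by (metis linear_add linear_cmul)
      also have "\<dots> = pf_proj L R x"
        using * mem by simp
      finally show ?thesis .
    qed
    then show "\<pi> = pf_proj L R" by blast
  qed (use lin zero fix' in auto)
  show "range (pf_proj L R) = pf_hyperplane L"
    using mem fix' by (metis image_subset_iff rangeI subsetI subset_antisym)
qed

text \<open>The sum of the Dirac masses at \<open>\<pi>(\<psi>(w\<^bsub>[1,m]\<^esub>))\<close> over the positions \<open>m\<close> with
  \<open>w\<^bsub>m+1\<^esub> = a\<close>, written as the push-forward of the counting measure on these positions.\<close>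

definition visit_measure ::
    "real^'a::finite \<Rightarrow> real^'a \<Rightarrow> 'a \<Rightarrow> 'a list \<Rightarrow> (real^'a) measure" where
  "visit_measure L R a w =
     distr (count_space {m. m < length w \<and> w ! m = a}) borel
       (\<lambda>m. pf_proj L R (abelianization (take m w)))"

lemma emeasure_visit_measure:
  assumes "B \<in> sets borel"
  shows "emeasure (visit_measure L R a w) B =
    (\<Sum>m | m < length w \<and> w ! m = a. indicator B (pf_proj L R (abelianization (take m w))))"
proof -
  let ?P = "{m. m < length w \<and> w ! m = a}"
  let ?f = "\<lambda>m. pf_proj L R (abelianization (take m w))"
  have "emeasure (visit_measure L R a w) B = emeasure (count_space ?P) (?f -` B \<inter> ?P)"
    unfolding visit_measure_def by (subst emeasure_distr) (use assms in auto)
  also have "\<dots> = (\<Sum>m\<in>?P. indicator (?f -` B) m)"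
    by (simp add: emeasure_count_space sum_indicator_eq_card Int_commute
        flip: of_nat_sum)
       (simp add: indicator_def of_nat_sum sum.If_cases Int_def conj_ac)
  finally show ?thesis by (simp add: indicator_def)
qed

text \<open>The expectation \<open>B \<mapsto> \<bbbE>[\<mu>(W)(B)]\<close> of a random measure \<open>\<mu>(W)\<close>, for \<open>W\<close> with law \<open>p\<close>.\<close>

definition expected_measure ::
    "'w pmf \<Rightarrow> ('w \<Rightarrow> 'b::topological_space measure) \<Rightarrow> 'b measure" where
  "expected_measure p \<mu> =
     measure_of UNIV (sets borel) (\<lambda>B. \<integral>\<^sup>+ w. emeasure (\<mu> w) B \<partial>measure_pmf p)"

lemma emeasure_expected_measure:
  assumes "\<And>w. sets (\<mu> w) = sets borel" "B \<in> sets borel"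
  shows "emeasure (expected_measure p \<mu>) B = (\<integral>\<^sup>+ w. emeasure (\<mu> w) B \<partial>measure_pmf p)"
proof (rule emeasure_measure_of[OF expected_measure_def])
  show "countably_additive (sets (expected_measure p \<mu>))
          (\<lambda>B. \<integral>\<^sup>+ w. emeasure (\<mu> w) B \<partial>measure_pmf p)"
  proof (rule countably_additiveI)
    fix A :: "nat \<Rightarrow> 'b set"
    assume A: "range A \<subseteq> sets (expected_measure p \<mu>)" "disjoint_family A"
    have "range A \<subseteq> sets borel"
      using A(1) by (simp add: expected_measure_def sets.sigma_sets_eq[of borel, simplified])
    then show "(\<Sum>i. \<integral>\<^sup>+ w. emeasure (\<mu> w) (A i) \<partial>measure_pmf p) =
        (\<integral>\<^sup>+ w. emeasure (\<mu> w) (\<Union> (range A)) \<partial>measure_pmf p)"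
      using A(2) assms(1)
      by (subst nn_integral_suminf[symmetric]) (auto intro!: nn_integral_cong suminf_emeasure)
  qed
  show "B \<in> sets (expected_measure p \<mu>)"
    using assms(2) by (simp add: expected_measure_def sets.sigma_sets_eq[of borel, simplified])
qed (auto simp: positive_def)

definition weakly_converges ::
    "(nat \<Rightarrow> 'b::topological_space measure) \<Rightarrow> 'b measure \<Rightarrow> bool" where
  "weakly_converges \<mu> m \<longleftrightarrow>
     (\<forall>f::'b \<Rightarrow> real. continuous_on UNIV f \<longrightarrow> bounded (range f) \<longrightarrow>
        (\<lambda>n. \<integral>x. f x \<partial>\<mu> n) \<longlonglongrightarrow> (\<integral>x. f x \<partial>m))"

text \<open>\<open>m\<close> is the Rauzy measure \<open>\<mu>\<^sub>a\<close>: the common weak limit for all non-empty words \<open>v\<close>. Measures on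
  the hyperplane are regarded as Borel measures on the ambient space; the limit \<open>m\<close> is
  automatically concentrated on the hyperplane, which is closed.\<close>

definition rauzy_measure ::
    "('a::finite \<Rightarrow> 'a list pmf) \<Rightarrow> real^'a \<Rightarrow> real^'a \<Rightarrow> 'a \<Rightarrow> (real^'a) measure \<Rightarrow> bool" where
  "rauzy_measure \<theta> L R a m \<longleftrightarrow> finite_measure m \<and> sets m = sets borel \<and>
     (\<forall>v. v \<noteq> [] \<longrightarrow>
        weakly_converges
          (\<lambda>n. scale_measure (ennreal (1 / real (iter_length \<theta> n v)))
                 (expected_measure (subst_iter \<theta> n v) (visit_measure L R a))) m)"

end

theory Submission
  imports Defs
begin

text \<open>
  Write \<open>\<pi>\<psi>(u)\<close> for the projection of the abelianization of \<open>u\<close>. Three facts carry the proof.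

  The matrix \<open>M\<close> contracts the hyperplane: \<open>\<parallel>M\<^sup>k x\<parallel> \<le> c\<^sub>k \<parallel>x\<parallel>\<close> for \<open>x\<close> orthogonal to \<open>L\<close>, with
  \<open>\<Sum> c\<^sub>k < \<infinity>\<close> (\<open>contraction_on_hyperplane\<close>). The eigenvalues there are Galois conjugates of the Pisot
  number other than itself, hence lie in the open unit disc. Expanding a prefix of an inflated word
  along the levels of inflation then shows that \<open>\<pi>\<psi>\<close> is bounded on the language
  (\<open>language_projection_bounded\<close>).

  An invariant \<open>\<nu>\<close> is also invariant under the \<open>k\<close>-th power of the random substitution, for every
  \<open>k\<close>. So, in law, the prefix of length \<open>n\<close> of a \<open>\<nu>\<close>-random sequence is a truncated concatenation
  \<open>W\<^sub>1 W\<^sub>2 \<dots> W\<^sub>N r\<close>, where the blocks are inflations of the letters of a legal word \<open>v\<close> and are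
  independent given \<open>v\<close>. Because of compatibility the lengths of the blocks are functions of \<open>v\<close>, and so is
  the number \<open>N\<close> of complete blocks among the first \<open>n\<close> letters. An exponential tail bound for the
  number of occurrences of each block and the Borel--Cantelli lemma show that almost surely, for every
  \<open>k\<close> and every tolerance, all long prefixes have such a parse in which the frequencies of the
  blocks are close to their conditional means (\<open>AE_balanced_parse\<close>). Only countably many null
  sets are discarded, and none of them depends on a test function.

  The rest is deterministic (\<open>balanced_parse_visit_sum\<close>). The block \<open>W\<^sub>i\<close> starts at
  \<open>\<pi>\<psi>(W\<^sub>1 \<dots> W\<^bsub>i-1\<^esub>) = M\<^sup>k \<pi>\<psi>(v\<^sub>1 \<dots> v\<^bsub>i-1\<^esub>)\<close>, a vector of norm at most \<open>c\<^sub>k\<close> times a constant. For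
  a continuous test function it can therefore be replaced by the origin at a small cost, by uniform
  continuity on a ball. What remains is a sum over blocks, each contributing its own visit sum. As
  the block frequencies are balanced, this sum is close to the sum of the conditional expectations;
  by the definition of the Rauzy measure, the expectation for an inflated letter is close to the
  integral times the length of the block when \<open>k\<close> is large.
\<close>

\<comment> \<open>Below, \<open>$\<close> always selects components of vectors and matrices.\<close>
no_notation fps_nth (infixl "$" 75)

section \<open>Orbits of matrices with small eigenvalues\<close>

text \<open>The vector \<open>q(M) v\<close>, written with iterates instead of matrix powers.\<close>


definition orbit_poly :: "'r::field^'n^'n \<Rightarrow> 'r poly \<Rightarrow> 'r^'n \<Rightarrow> 'r^'n" where
  "orbit_poly M q v = (\<Sum>i\<le>degree q. coeff q i *s ((*v) M ^^ i) v)"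

lemma orbit_poly_upto:
  assumes "degree q \<le> n"
  shows "orbit_poly M q v = (\<Sum>i\<le>n. coeff q i *s ((*v) M ^^ i) v)"
  unfolding orbit_poly_def
  by (rule sum.mono_neutral_left) (use assms in \<open>auto simp: coeff_eq_0\<close>)

lemma matrix_iter_shift:
  fixes M :: "'r::field^'n^'n"
  shows "((*v) M ^^ i) (M *v v) = M *v ((*v) M ^^ i) v"
  by (simp add: funpow_swap1)

lemma matrix_iter_add:
  fixes M :: "'r::field^'n^'n"
  shows "((*v) M ^^ i) (x + y) = ((*v) M ^^ i) x + ((*v) M ^^ i) y"
  by (induction i) (auto simp: matrix_vector_right_distrib)

lemma matrix_iter_scale:
  fixes M :: "'r::field^'n^'n"
  shows "((*v) M ^^ i) (c *s x) = c *s ((*v) M ^^ i) x"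
  by (induction i) (auto simp: vector_scalar_commute)

lemma matrix_iter_shifted_diff:
  fixes M :: "'r::field^'n^'n"
  shows "((*v) M ^^ i) (M *v v - z *s v) = ((*v) M ^^ Suc i) v - z *s ((*v) M ^^ i) v"
  using matrix_iter_add[of i M "M *v v" "(- z) *s v"]
    matrix_iter_scale[of i M "- z" v]
  by (simp add: matrix_iter_shift)

text \<open>A root \<open>z\<close> of the polynomial can be moved into the vector: \<open>((X - z) q)(M) v = q(M) (M v - z v)\<close>. This
  drives the induction on the degree in \<open>summable_orbit_on_stable_subspace\<close>.\<close>

lemma orbit_poly_linear_factor:
  "orbit_poly M ([:- z, 1:] * q) v = orbit_poly M q (M *v v - z *s v)"
proof -
  let ?n = "degree q"
  have deg: "degree ([:- z, 1:] * q) \<le> Suc ?n"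
    using degree_mult_le[of "[:- z, 1:]" q] by simp
  have eq: "[:- z, 1:] * q = pCons 0 q + smult (- z) q"
    by simp
  have "orbit_poly M ([:- z, 1:] * q) v
      = (\<Sum>i\<le>Suc ?n. coeff (pCons 0 q) i *s ((*v) M ^^ i) v)
        - (\<Sum>i\<le>Suc ?n. (z * coeff q i) *s ((*v) M ^^ i) v)"
    unfolding orbit_poly_upto[OF deg] sum_subtractf[symmetric]
    by (rule sum.cong[OF refl])
      (simp only: eq coeff_add coeff_smult vec.scale_left_distrib vec.scale_minus_left
        mult_minus_left diff_conv_add_uminus)
  also have "(\<Sum>i\<le>Suc ?n. coeff (pCons 0 q) i *s ((*v) M ^^ i) v)
      = (\<Sum>i\<le>?n. coeff q i *s ((*v) M ^^ Suc i) v)"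
    by (subst sum.atMost_Suc_shift) simp
  also have "(\<Sum>i\<le>Suc ?n. (z * coeff q i) *s ((*v) M ^^ i) v)
      = (\<Sum>i\<le>?n. (z * coeff q i) *s ((*v) M ^^ i) v)"
    by (simp add: coeff_eq_0)
  finally show ?thesis
    by (simp only: orbit_poly_def matrix_iter_shifted_diff vec.scale_right_diff_distrib
        sum_subtractf vec.scale_scale mult.commute)
qed

text \<open>The \<open>n + 1\<close> vectors \<open>v, M v, \<dots>, M\<^sup>n v\<close> of an \<open>n\<close>-dimensional space are linearly dependent, and a
  dependence is a polynomial that annihilates \<open>v\<close>. If two of these vectors coincide they do not
  form a set of \<open>n + 1\<close> elements; then a difference of two monomials does it.\<close>

lemma ex_annihilating_poly:
  fixes M :: "'r::field^'n^'n"
  shows "\<exists>q. q \<noteq> 0 \<and> orbit_poly M q v = 0"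
proof -
  let ?n = "CARD('n)"
  let ?f = "\<lambda>i. ((*v) M ^^ i) v"
  show ?thesis
  proof (cases "inj_on ?f {..?n}")
    case True
    have "vec.dependent (?f ` {..?n})"
    proof (rule vec.dependent_biggerset_general)
      show "vec.dim (?f ` {..?n}) < card (?f ` {..?n})"
        using card_image[OF True] dim_subset_UNIV_cart_gen[of "?f ` {..?n}"]
        by simp
    qed
    then obtain u w where u: "(\<Sum>x\<in>?f ` {..?n}. u x *s x) = 0"
      and w: "w \<in> ?f ` {..?n}" "u w \<noteq> 0"
      using vec.dependent_finite[of "?f ` {..?n}"] by auto
    then obtain j where j: "j \<le> ?n" "u (?f j) \<noteq> 0" by auto
    define q where "q = (\<Sum>i\<le>?n. monom (u (?f i)) i)"
    have cq: "coeff q i = (if i \<le> ?n then u (?f i) else 0)" for i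
      unfolding q_def by (simp add: coeff_sum)
    have "degree q \<le> ?n"
      by (rule degree_le) (simp add: cq)
    then have "orbit_poly M q v = (\<Sum>i\<le>?n. u (?f i) *s ?f i)"
      by (subst orbit_poly_upto, assumption) (simp add: cq)
    also have "\<dots> = 0"
      using u by (simp add: sum.reindex[OF True])
    finally have "orbit_poly M q v = 0" .
    moreover have "q \<noteq> 0" using cq[of j] j by auto
    ultimately show ?thesis by blast
  next
    case False
    then obtain i j where ij: "i < j" "?f i = ?f j"
      unfolding inj_on_def by (metis linorder_neqE_nat)
    define q :: "'r poly" where "q = monom 1 i - monom 1 j"
    have cq: "coeff q k = (if k = i then 1 else 0) - (if k = j then 1 else 0)" for k
      by (simp add: q_def)
    have "degree q \<le> j"
      by (rule degree_le) (use ij in \<open>simp add: cq\<close>)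
    then have "orbit_poly M q v = (\<Sum>k\<le>j. coeff q k *s ?f k)"
      by (rule orbit_poly_upto)
    also have "\<dots> = (\<Sum>k\<le>j. (if k = i then ?f k else 0) - (if k = j then ?f k else 0))"
      by (rule sum.cong) (use ij(1) in \<open>auto simp: cq vec_eq_iff\<close>)
    also have "\<dots> = ?f i - ?f j"
      using ij(1) by (simp add: sum_subtractf)
    finally have "orbit_poly M q v = 0" using ij by simp
    moreover have "coeff q j = -1" using ij by (simp add: cq)
    then have "q \<noteq> 0" by auto
    ultimately show ?thesis by blast
  qed
qed

lemma norm_vector_scale: "norm (z *s x) = cmod z * norm (x :: complex^'n)"
  by (simp add: norm_vec_def norm_mult L2_set_right_distrib)

text \<open>With \<open>s\<^sub>n\<close> the partial sums of the norms, the recursion gives \<open>s\<^sub>n \<le> \<parallel>x\<^sub>0\<parallel> + |z| s\<^sub>n + \<Sum> \<parallel>y\<^sub>k\<parallel>\<close>, so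
  they are bounded when \<open>|z| < 1\<close>.\<close>

lemma summable_linear_recursion:
  fixes x :: "nat \<Rightarrow> complex^'n"
  assumes z: "cmod z < 1" and s: "summable (\<lambda>k. norm (y k))"
    and rec: "\<And>k. x (Suc k) = z *s x k + y k"
  shows "summable (\<lambda>k. norm (x k))"
proof (rule summableI_nonneg_bounded)
  fix n
  show "0 \<le> norm (x n)" by simp
  let ?S = "\<Sum>k. norm (y k)"
  have "(\<Sum>k<n. norm (x k)) \<le> (\<Sum>k<Suc n. norm (x k))"
    by simp
  also have "\<dots> = norm (x 0) + (\<Sum>k<n. norm (x (Suc k)))"
    by (rule sum.lessThan_Suc_shift)
  also have "(\<Sum>k<n. norm (x (Suc k))) \<le> (\<Sum>k<n. cmod z * norm (x k) + norm (y k))"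
    by (rule sum_mono) (metis norm_triangle_ineq norm_vector_scale rec)
  also have "\<dots> = cmod z * (\<Sum>k<n. norm (x k)) + (\<Sum>k<n. norm (y k))"
    by (simp add: sum.distrib sum_distrib_left)
  also have "(\<Sum>k<n. norm (y k)) \<le> ?S"
    by (rule sum_le_suminf) (use s in auto)
  finally have "(1 - cmod z) * (\<Sum>k<n. norm (x k)) \<le> norm (x 0) + ?S"
    by (simp add: algebra_simps)
  then show "(\<Sum>k<n. norm (x k)) \<le> (norm (x 0) + ?S) / (1 - cmod z)"
    using z by (simp add: field_simps)
qed

lemma orbit_poly_mem:
  assumes V: "vec.subspace V" "\<And>x. x \<in> V \<Longrightarrow> M *v x \<in> V" and "v \<in> V"
  shows "orbit_poly (M :: 'r::field^'n^'n) q v \<in> V"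
proof -
  have "((*v) M ^^ i) v \<in> V" for i
    by (induction i) (use V assms(3) in auto)
  then show ?thesis
    unfolding orbit_poly_def by (auto intro!: vec.subspace_sum vec.subspace_scale V)
qed

text \<open>Asking for summability of the orbit instead of a geometric rate avoids the Jordan normal form. Let
  \<open>q(M) v = 0\<close>, let \<open>z\<close> be a root of \<open>q = (X - z) q\<^sub>1\<close> and put \<open>w = M v - z v\<close>, so that \<open>q\<^sub>1(M) w = 0\<close>.
  Either \<open>q\<^sub>1(M) v\<close> vanishes already, or it is an eigenvector for \<open>z\<close> in the subspace and \<open>|z| < 1\<close>;
  in that case the orbit of \<open>v\<close> solves a linear recursion whose inhomogeneity is the orbit of \<open>w\<close>,
  summable by induction on the degree.\<close>

lemma summable_orbit_on_stable_subspace: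
  fixes M :: "complex^'n^'n"
  assumes V: "vec.subspace V" "\<And>x. x \<in> V \<Longrightarrow> M *v x \<in> V"
    and eig: "\<And>u z. u \<in> V \<Longrightarrow> u \<noteq> 0 \<Longrightarrow> M *v u = z *s u \<Longrightarrow> cmod z < 1"
    and "v \<in> V"
  shows "summable (\<lambda>k. norm (((*v) M ^^ k) v))"
proof -
  have main: "summable (\<lambda>k. norm (((*v) M ^^ k) v))"
    if "q \<noteq> 0" "orbit_poly M q v = 0" "v \<in> V" "degree q = n" for q v n
    using that
  proof (induction n arbitrary: q v)
    case 0
    then have "v = 0"
      by (auto simp: orbit_poly_def elim!: degree_eq_zeroE)
    then have "((*v) M ^^ k) v = 0" for k by (induction k) auto
    then show ?case by simp
  next
    case (Suc n)
    then have "\<not> constant (poly q)" by (simp add: constant_degree)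
    then obtain z where "poly q z = 0"
      using fundamental_theorem_of_algebra by blast
    then obtain q1 where q: "q = [:- z, 1:] * q1"
      by (auto simp: poly_eq_0_iff_dvd)
    have q1: "q1 \<noteq> 0" using q Suc.prems(1) by auto
    then have "degree q = Suc (degree q1)"
      unfolding q by (subst degree_mult_eq) auto
    with Suc.prems(4) q1 have q1: "q1 \<noteq> 0" "degree q1 = n" by auto
    let ?w = "M *v v - z *s v"
    let ?u = "orbit_poly M q1 v"
    have u: "?u \<in> V" by (rule orbit_poly_mem) (use V Suc.prems in auto)
    have w: "?w \<in> V"
      using Suc.prems V by (auto intro!: vec.subspace_diff vec.subspace_scale)
    have ow: "orbit_poly M q1 ?w = 0"
      using Suc.prems(2) by (simp only: q orbit_poly_linear_factor)
    have split: "orbit_poly M q1 ?w = M *v ?u - z *s ?u"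
    proof -
      have "orbit_poly M q1 ?w
          = (\<Sum>i\<le>degree q1. coeff q1 i *s (M *v ((*v) M ^^ i) v))
            - (\<Sum>i\<le>degree q1. z *s (coeff q1 i *s ((*v) M ^^ i) v))"
        by (simp only: orbit_poly_def matrix_iter_shifted_diff vec.scale_right_diff_distrib
            sum_subtractf vec.scale_scale mult.commute funpow.simps comp_def)
      also have "(\<Sum>i\<le>degree q1. coeff q1 i *s (M *v ((*v) M ^^ i) v)) = M *v ?u"
        unfolding orbit_poly_def
        by (simp only: vec.linear_sum[OF matrix_vector_mul_linear_gen] vector_scalar_commute)
      also have "(\<Sum>i\<le>degree q1. z *s (coeff q1 i *s ((*v) M ^^ i) v)) = z *s ?u"
        unfolding orbit_poly_def by (simp only: vec.scale_sum_right)
      finally show ?thesis .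
    qed
    show ?case
    proof (cases "?u = 0")
      case True
      then show ?thesis using Suc.IH[OF q1(1) True Suc.prems(3) q1(2)] by simp
    next
      case False
      then have "cmod z < 1"
        using eig[OF u False] ow split by simp
      moreover have "summable (\<lambda>k. norm (((*v) M ^^ k) ?w))"
        by (rule Suc.IH[OF q1(1) ow w q1(2)])
      moreover have "((*v) M ^^ Suc k) v = z *s ((*v) M ^^ k) v + ((*v) M ^^ k) ?w" for k
        using matrix_iter_add[of k M "z *s v" ?w]
        by (simp add: matrix_iter_scale matrix_iter_shift)
      ultimately show ?thesis by (rule summable_linear_recursion)
    qed
  qed
  obtain q where "q \<noteq> 0" "orbit_poly M q v = 0" using ex_annihilating_poly by blast
  then show ?thesis using main assms(4) by blast
qed



section \<open>Eigenvalues of an irreducible Pisot matrix\<close>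

definition int_poly_eval :: "int poly \<Rightarrow> 'r::comm_ring_1 \<Rightarrow> 'r" where
  "int_poly_eval p z = poly (map_poly of_int p) z"

lemma int_poly_eval_pCons: "int_poly_eval (pCons a p) z = of_int a + z * int_poly_eval p z"
  by (simp add: int_poly_eval_def map_poly_pCons)

lemma int_poly_eval_0: "int_poly_eval 0 z = 0"
  by (simp add: int_poly_eval_def)

lemma int_poly_eval_add: "int_poly_eval (p + q) z = int_poly_eval p z + int_poly_eval q z"
  by (induction p q rule: poly_induct2) (auto simp: int_poly_eval_pCons int_poly_eval_0 algebra_simps)

lemma int_poly_eval_smult: "int_poly_eval (smult c p) z = of_int c * int_poly_eval p z"
  by (induction p) (auto simp: int_poly_eval_pCons int_poly_eval_0 algebra_simps)

lemma int_poly_eval_mult: "int_poly_eval (p * q) z = int_poly_eval p z * int_poly_eval q z"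
  by (induction p)
    (auto simp: int_poly_eval_pCons int_poly_eval_0 int_poly_eval_add int_poly_eval_smult algebra_simps)

lemma int_poly_eval_const: "int_poly_eval [:c:] z = of_int c"
  by (simp add: int_poly_eval_pCons int_poly_eval_0)

lemma int_poly_eval_1: "int_poly_eval 1 z = 1"
  by (simp add: int_poly_eval_def)

lemma int_poly_eval_sum: "int_poly_eval (sum f S) z = (\<Sum>i\<in>S. int_poly_eval (f i) z)"
  by (induction S rule: infinite_finite_induct) (auto simp: int_poly_eval_0 int_poly_eval_add)

lemma int_poly_eval_prod: "int_poly_eval (prod f S) z = (\<Prod>i\<in>S. int_poly_eval (f i) z)"
  by (induction S rule: infinite_finite_induct)
    (auto simp: int_poly_eval_1 int_poly_eval_mult)

lemma int_poly_eval_of_int: "int_poly_eval (of_int c) z = of_int c"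
  by (simp add: of_int_poly int_poly_eval_const)

text \<open>Evaluation is a ring homomorphism, so it commutes with determinants.\<close>

lemma int_poly_eval_det:
  "int_poly_eval (det A) z = det (\<chi> i j. int_poly_eval (A $ i $ j) z)"
  by (simp add: det_def int_poly_eval_sum int_poly_eval_mult int_poly_eval_of_int
      int_poly_eval_prod)

lemma eigenvalue_charpoly_root:
  fixes A :: "int^'n^'n" and u :: "complex^'n"
  assumes eig: "(\<chi> i j. of_int (A $ i $ j)) *v u = z *s u" and "u \<noteq> 0"
  shows "int_poly_eval (charpoly A) z = 0"
proof -
  let ?B = "(\<chi> i j. int_poly_eval ((mat [:0, 1:] - (\<chi> i j. [:A $ i $ j:])) $ i $ j) z) :: complex^'n^'n"
  have B: "?B = mat z - (\<chi> i j. of_int (A $ i $ j))"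
    by (simp add: vec_eq_iff mat_def int_poly_eval_pCons int_poly_eval_0)
  have "mat z *v u = z *s u"
    by (simp add: vec_eq_iff matrix_vector_mult_def mat_def if_distrib if_distribR cong: if_cong)
  then have "?B *v u = 0"
    unfolding B by (simp add: matrix_vector_mult_diff_rdistrib eig)
  then have "\<not> invertible ?B"
    using \<open>u \<noteq> 0\<close> matrix_left_invertible_ker[of ?B] by (auto simp: invertible_def)
  then show ?thesis
    by (simp add: charpoly_def int_poly_eval_det invertible_det_nz)
qed

text \<open>Let \<open>g\<close> be a nonzero integer polynomial of least degree vanishing at \<open>x\<close>. By pseudo-division it divides an
  integer multiple of every integer polynomial that vanishes at \<open>x\<close>; conversely an irreducible such
  polynomial \<open>q\<close>, being prime, divides \<open>g\<close>. Hence the roots of \<open>q\<close> are roots of \<open>g\<close>, and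
  roots of \<open>g\<close> are roots of \<open>p\<close>.\<close>

lemma irreducible_int_polys_common_root:
  fixes p q :: "int poly" and x z :: complex
  assumes p: "irreducible p" "int_poly_eval p x = 0"
    and q: "irreducible q" "int_poly_eval q x = 0"
    and z: "int_poly_eval q z = 0"
  shows "int_poly_eval p z = 0"
proof -
  define P where "P = (\<lambda>g::int poly. g \<noteq> 0 \<and> int_poly_eval g x = 0)"
  define g where "g = arg_min degree P"
  have "P p" using p by (auto simp: P_def)
  then have g: "P g" and min: "\<And>h. P h \<Longrightarrow> degree g \<le> degree h"
    unfolding g_def by (auto intro: arg_min_natI arg_min_nat_le)
  have div: "\<exists>a s. a \<noteq> 0 \<and> smult a f = g * s" if "int_poly_eval f x = 0" for f
  proof -
    have g0: "g \<noteq> 0" using g by (simp add: P_def)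
    obtain a s where as: "a \<noteq> 0" "smult a f = g * s + pseudo_mod f g"
      using pseudo_mod(1)[OF g0] by blast
    have "int_poly_eval (smult a f) x = int_poly_eval (g * s + pseudo_mod f g) x"
      using as by simp
    then have "int_poly_eval (pseudo_mod f g) x = 0"
      using that g by (simp add: int_poly_eval_smult int_poly_eval_add int_poly_eval_mult P_def)
    then have "pseudo_mod f g = 0"
      using pseudo_mod(2)[OF g0, of f] min[of "pseudo_mod f g"] by (metis P_def linorder_not_le)
    with as show ?thesis by auto
  qed
  \<comment> \<open>If \<open>q\<close> divided the cofactor \<open>s\<close> instead of \<open>g\<close>, then \<open>g\<close> would divide a constant.\<close>
  have g_nc: "degree g \<noteq> 0"
  proof
    assume "degree g = 0"
    then obtain c where "g = [:c:]" by (rule degree_eq_zeroE)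
    with g show False by (auto simp: P_def int_poly_eval_const)
  qed
  have dvd: "q dvd g"
  proof -
    obtain a s where as: "a \<noteq> 0" "smult a q = g * s" using div[OF q(2)] by blast
    have "q dvd g * s" by (metis as(2) dvd_refl dvd_smult)
    then consider "q dvd g" | "q dvd s"
      using irreducible_imp_prime_poly[OF q(1)] by (auto simp: prime_elem_dvd_mult_iff)
    then show ?thesis
    proof cases
      case 2
      then obtain t where "s = q * t" by (auto elim: dvdE)
      with as have "q * [:a:] = q * (g * t)" by (simp add: mult_ac)
      moreover have "q \<noteq> 0" using q by auto
      ultimately have "[:a:] = g * t" by (metis mult_left_cancel)
      moreover have "[:a:] \<noteq> 0" using as by simp
      ultimately have "degree g = 0"
        using degree_mult_eq[of g t] by (metis add_is_0 degree_pCons_0 mult_zero_left mult_zero_right)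
      with g_nc show ?thesis by simp
    qed
  qed
  then have "int_poly_eval g z = 0"
    using z by (auto elim!: dvdE simp: int_poly_eval_mult)
  moreover obtain a s where "a \<noteq> 0" "smult a p = g * s" using div[OF p(2)] by blast
  ultimately have "of_int a * int_poly_eval p z = 0"
    by (metis int_poly_eval_smult int_poly_eval_mult mult_zero_left)
  with \<open>a \<noteq> 0\<close> show ?thesis by simp
qed

text \<open>The characteristic polynomial and the minimal polynomial of the Pisot number \<open>l\<close> are irreducible over the integers and
  share the root \<open>l\<close>. So every eigenvalue is a Galois conjugate of \<open>l\<close>.\<close>

lemma pisot_other_eigenvalues:
  fixes A :: "int^'n^'n" and u v :: "complex^'n"
  assumes "pisot_number l" "irreducible (charpoly A)"
    and v: "(\<chi> i j. of_int (A $ i $ j)) *v v = of_real l *s v" "v \<noteq> 0"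
    and u: "(\<chi> i j. of_int (A $ i $ j)) *v u = z *s u" "u \<noteq> 0"
    and "z \<noteq> of_real l"
  shows "cmod z < 1"
proof -
  obtain p :: "int poly" where p: "irreducible p" "poly (map_poly of_int p) l = 0"
    and conj: "\<And>z::complex. poly (map_poly of_int p) z = 0 \<Longrightarrow> z \<noteq> of_real l \<Longrightarrow> cmod z < 1"
    using assms(1) unfolding pisot_number_def by blast
  have "int_poly_eval p (complex_of_real l) = of_real (int_poly_eval p l)"
    by (induction p) (simp_all add: int_poly_eval_0 int_poly_eval_pCons)
  then have "int_poly_eval p (complex_of_real l) = 0"
    using p(2) by (simp add: int_poly_eval_def)
  then have "int_poly_eval p z = 0"
    using irreducible_int_polys_common_root[OF p(1) _ assms(2)
        eigenvalue_charpoly_root[OF v] eigenvalue_charpoly_root[OF u]] by blast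
  with conj assms(7) show ?thesis by (simp add: int_poly_eval_def)
qed

lemma matrix_power_vector:
  fixes M :: "'r::field^'n^'n"
  shows "(((**) M ^^ k) (mat 1)) *v x = ((*v) M ^^ k) x"
  by (induction k) (auto simp flip: matrix_vector_mul_assoc)

text \<open>A strictly positive power of \<open>M\<close> maps a nonzero nonnegative vector to a strictly positive one, and it acts
  on an eigenvector as a positive scalar.\<close>

lemma nonneg_pf_eigenvector_positive:
  fixes M :: "real^'n^'n"
  assumes M: "primitive_matrix M" and x: "\<And>i. 0 \<le> x $ i" "x $ j \<noteq> 0"
    and eig: "M *v x = l *s x" and "0 < l"
  shows "0 < x $ i"
proof -
  obtain k where k: "\<And>i j. 0 < (((**) M ^^ k) (mat 1)) $ i $ j"
    using M unfolding primitive_matrix_def by blast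
  have "((*v) M ^^ k) x = (l ^ k) *s x"
    by (induction k) (auto simp: eig vector_scalar_commute vector_smult_assoc mult.commute)
  from this[folded matrix_power_vector, THEN arg_cong[where f = "\<lambda>y. y $ i"]]
  have "l ^ k * x $ i = (\<Sum>m\<in>UNIV. (((**) M ^^ k) (mat 1)) $ i $ m * x $ m)"
    by (simp add: matrix_vector_mult_def)
  also have "\<dots> > 0"
    by (rule sum_pos2[of _ j]) (use k x in \<open>auto simp: less_le\<close>)
  finally show ?thesis
    using \<open>0 < l\<close> by (simp add: zero_less_mult_iff)
qed

text \<open>The vector \<open>|x|\<close> of absolute values satisfies \<open>M |x| \<ge> l |x|\<close>; pairing with the positive left eigenvector
  turns this into an equality. So \<open>|x| + x\<close> and \<open>|x| - x\<close> are nonnegative eigenvectors, each of them zero or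
  strictly positive. If \<open>x \<noteq> 0\<close>, all entries of \<open>x\<close> therefore have the same strict sign, which
  contradicts \<open>L \<bullet> x = 0\<close>.\<close>

lemma pf_eigenspace_meets_hyperplane:
  fixes M :: "real^'n^'n"
  assumes M: "primitive_matrix M" and L: "L v* M = l *\<^sub>R L" "\<And>i. 0 < L $ i" and "0 < l"
    and x: "M *v x = l *s x" "L \<bullet> x = 0"
  shows "x = 0"
proof -
  have Mnn: "0 \<le> M $ i $ j" for i j using M by (auto simp: primitive_matrix_def)
  define y where "y = (\<chi> i. \<bar>x $ i\<bar>)"
  have le: "l * y $ i \<le> (M *v y) $ i" for i
  proof -
    have "l * y $ i = \<bar>(M *v x) $ i\<bar>"
      using x \<open>0 < l\<close> by (simp add: y_def abs_mult)
    also have "\<dots> \<le> (\<Sum>j\<in>UNIV. \<bar>M $ i $ j * x $ j\<bar>)"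
      by (simp add: matrix_vector_mult_def)
    also have "\<dots> = (M *v y) $ i"
      by (simp add: matrix_vector_mult_def y_def abs_mult Mnn)
    finally show ?thesis .
  qed
  have "L \<bullet> (M *v y) = l * (L \<bullet> y)"
    by (simp add: dot_lmul_matrix[symmetric] L)
  then have "(\<Sum>i\<in>UNIV. L $ i * ((M *v y) $ i - l * y $ i)) = 0"
    by (simp add: inner_vec_def right_diff_distrib sum_subtractf sum_distrib_left mult_ac)
  then have "L $ i * ((M *v y) $ i - l * y $ i) = 0" for i
    by (subst (asm) sum_nonneg_eq_0_iff) (use le L(2) in \<open>auto simp: less_imp_le\<close>)
  then have y: "M *v y = l *s y"
    using L(2) by (auto simp: vec_eq_iff less_le)
  define p where "p = y + x"
  have p: "M *v p = l *s p" "\<And>i. 0 \<le> p $ i"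
    using x y by (auto simp: p_def y_def matrix_vector_right_distrib vector_add_ldistrib)
  define m where "m = y - x"
  have m: "M *v m = l *s m" "\<And>i. 0 \<le> m $ i"
    using x y by (auto simp: m_def y_def matrix_vector_mult_diff_distrib vector_ssub_ldistrib)
  show ?thesis
  proof (rule ccontr)
    assume "x \<noteq> 0"
    then obtain i where i: "x $ i \<noteq> 0" by (auto simp: vec_eq_iff)
    have sgn: "(\<forall>i. 0 < x $ i) \<or> (\<forall>i. x $ i < 0)"
    proof (cases "0 < x $ i")
      case True
      then have pos: "0 < p $ j" for j
        using nonneg_pf_eigenvector_positive[OF M p(2) _ p(1) \<open>0 < l\<close>, of i j]
        by (simp add: p_def y_def)
      have "0 < x $ j" for j
        using pos[of j] by (simp add: p_def y_def abs_if split: if_splits)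
      then show ?thesis by blast
    next
      case False
      then have pos: "0 < m $ j" for j
        using nonneg_pf_eigenvector_positive[OF M m(2) _ m(1) \<open>0 < l\<close>, of i j] i
        by (simp add: m_def y_def)
      have "x $ j < 0" for j
        using pos[of j] by (simp add: m_def y_def abs_if split: if_splits)
      then show ?thesis by blast
    qed
    have "(\<Sum>i\<in>UNIV. L $ i * \<bar>x $ i\<bar>) > 0"
      by (rule sum_pos2[of _ i]) (use L(2) i in \<open>auto simp: less_imp_le\<close>)
    moreover have "(\<Sum>i\<in>UNIV. L $ i * \<bar>x $ i\<bar>) = \<bar>L \<bullet> x\<bar>"
    proof -
      have "(\<Sum>i\<in>UNIV. L $ i * \<bar>x $ i\<bar>) = (L \<bullet> x) \<or> (\<Sum>i\<in>UNIV. L $ i * \<bar>x $ i\<bar>) = - (L \<bullet> x)"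
        using sgn
      proof
        assume "\<forall>i. 0 < x $ i"
        then have "\<bar>x $ i\<bar> = x $ i" for i by (simp add: less_imp_le)
        then show ?thesis by (simp add: inner_vec_def)
      next
        assume "\<forall>i. x $ i < 0"
        then have "\<bar>x $ i\<bar> = - x $ i" for i by (simp add: less_imp_le)
        then show ?thesis by (simp add: inner_vec_def sum_negf)
      qed
      then show ?thesis using calculation by linarith
    qed
    ultimately show False using x by simp
  qed
qed

lemma subst_matrix_complex:
  "(subst_matrix \<theta> :: complex^'a^'a) = (\<chi> i j. of_real ((subst_matrix \<theta> :: real^'a^'a) $ i $ j))"
  by (simp add: vec_eq_iff subst_matrix_def)

lemma subst_matrix_complex_int:
  "(\<chi> i j. of_int ((subst_matrix \<theta> :: int^'a^'a) $ i $ j)) = (subst_matrix \<theta> :: complex^'a^'a)"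
  by (simp add: vec_eq_iff subst_matrix_def)

definition complexify :: "real^'n \<Rightarrow> complex^'n" where
  "complexify x = (\<chi> i. of_real (x $ i))"

lemma complexify_matrix:
  "(subst_matrix \<theta> :: complex^'a^'a) *v complexify x = complexify (subst_matrix \<theta> *v x)"
  by (simp add: vec_eq_iff complexify_def subst_matrix_complex matrix_vector_mult_def)

lemma norm_complexify: "norm (complexify x) = norm x"
  by (simp add: norm_vec_def complexify_def)

text \<open>The eigenvalue condition has to be checked over the complex numbers, on the subspace \<open>V\<close> of vectors whose real
  and imaginary parts are orthogonal to \<open>L\<close>. The Perron--Frobenius eigenvalue does not occur on \<open>V\<close>, and
  all other eigenvalues have modulus less than 1.\<close>

lemma irreducible_pisot_summable_orbit:
  fixes \<theta> :: "'a::finite \<Rightarrow> 'a list pmf"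
  assumes irr: "irreducible_pisot \<theta>" and ev: "pf_eigenvectors \<theta> L R" and x: "L \<bullet> x = 0"
  shows "summable (\<lambda>k. norm (((*v) (subst_matrix \<theta>) ^^ k) x))"
proof -
  let ?M = "subst_matrix \<theta> :: real^'a^'a"
  let ?C = "subst_matrix \<theta> :: complex^'a^'a"
  let ?l = "pf_eigenvalue \<theta>"
  have prim: "primitive_matrix ?M" and l: "0 < ?l" and pis: "pisot_number ?l"
    and chi: "irreducible (charpoly (subst_matrix \<theta> :: int^'a^'a))"
    using irr by (auto simp: irreducible_pisot_def primitive_subst_def)
  have L: "L v* ?M = ?l *\<^sub>R L" "\<And>i. 0 < L $ i" and R: "?M *v R = ?l *\<^sub>R R" "\<And>i. 0 < R $ i"
    using ev by (auto simp: pf_eigenvectors_def)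
  have LM: "L \<bullet> (?M *v y) = ?l * (L \<bullet> y)" for y
    by (simp add: dot_lmul_matrix[symmetric] L)
  define re where "re = (\<lambda>u::complex^'a. (\<chi> i. Re (u $ i)) :: real^'a)"
  define im where "im = (\<lambda>u::complex^'a. (\<chi> i. Im (u $ i)) :: real^'a)"
  have reM: "re (?C *v u) = ?M *v re u" and imM: "im (?C *v u) = ?M *v im u" for u
    by (auto simp: re_def im_def vec_eq_iff matrix_vector_mult_def subst_matrix_complex)
  define V where "V = {u. L \<bullet> re u = 0 \<and> L \<bullet> im u = 0}"
  have V: "vec.subspace V"
  proof (rule vec.subspaceI)
    show "c *s u \<in> V" if "u \<in> V" for c u
    proof -
      have "re (c *s u) = Re c *\<^sub>R re u - Im c *\<^sub>R im u"
        "im (c *s u) = Re c *\<^sub>R im u + Im c *\<^sub>R re u"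
        by (auto simp: re_def im_def vec_eq_iff)
      then show ?thesis using that by (simp add: V_def inner_diff_right inner_add_right)
    qed
    show "u + v \<in> V" if "u \<in> V" "v \<in> V" for u v
    proof -
      have "re (u + v) = re u + re v" "im (u + v) = im u + im v"
        by (auto simp: re_def im_def vec_eq_iff)
      then show ?thesis using that by (simp add: V_def inner_add_right)
    qed
  qed (auto simp: V_def re_def im_def inner_vec_def)
  have VM: "?C *v u \<in> V" if "u \<in> V" for u
    using that by (simp add: V_def reM imM LM)
  have eig: "cmod z < 1" if u: "u \<in> V" "u \<noteq> 0" "?C *v u = z *s u" for u z
  proof -
    have "z \<noteq> of_real ?l"
    proof
      assume z: "z = of_real ?l"
      have "?M *v re u = ?l *s re u" "?M *v im u = ?l *s im u"
        unfolding reM[symmetric] imM[symmetric] u(3) z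
        by (auto simp: re_def im_def vec_eq_iff)
      then have "re u = 0" "im u = 0"
        using pf_eigenspace_meets_hyperplane[OF prim L l] u(1) by (auto simp: V_def)
      then have "u = 0" by (auto simp: re_def im_def vec_eq_iff complex_eq_iff)
      with u(2) show False by simp
    qed
    moreover have "?C *v complexify R = of_real ?l *s complexify R"
      by (simp add: complexify_matrix R) (simp add: complexify_def vec_eq_iff)
    moreover have "complexify R \<noteq> 0"
      using R(2) by (auto simp: complexify_def vec_eq_iff less_le)
    ultimately show ?thesis
      using pisot_other_eigenvalues[OF pis chi, unfolded subst_matrix_complex_int] u by blast
  qed
  have iter: "((*v) ?C ^^ k) (complexify x) = complexify (((*v) ?M ^^ k) x)" for k
    by (induction k) (simp_all add: complexify_matrix)
  have "complexify x \<in> V"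
    using x by (simp add: V_def re_def im_def complexify_def inner_vec_def)
  from summable_orbit_on_stable_subspace[OF V VM eig this]
  show ?thesis by (simp add: iter norm_complexify)
qed



section \<open>Inflated words\<close>

lemma abelianization_Nil [simp]: "abelianization [] = 0"
  by (simp add: abelianization_def vec_eq_iff)

lemma abelianization_append [simp]:
  "abelianization (u @ v) = abelianization u + abelianization v"
  by (simp add: abelianization_def vec_eq_iff)

lemma abelianization_Cons: "abelianization (a # u) = abelianization [a] + abelianization u"
  using abelianization_append[of "[a]" u] by simp

lemma length_abelianization:
  fixes u :: "'a::finite list"
  shows "real (length u) = (\<Sum>i\<in>UNIV. abelianization u $ i)"
proof -
  have "length u = (\<Sum>i\<in>UNIV. count_list u i)"
    using sum_count_set[of u UNIV] by simp
  then show ?thesis by (simp add: abelianization_def)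
qed

lemma abelianization_subst_letter:
  assumes "compatible \<theta>" "v \<in> set_pmf (\<theta> j)"
  shows "subst_matrix \<theta> *v abelianization [j] = abelianization v"
proof -
  have "(SOME v. v \<in> set_pmf (\<theta> j)) \<in> set_pmf (\<theta> j)"
    using assms(2) by (rule someI)
  then have "abelianization (SOME v. v \<in> set_pmf (\<theta> j)) = abelianization v"
    using assms unfolding compatible_def by blast
  moreover have "abelianization [j] = axis j 1"
    by (simp add: abelianization_def axis_def vec_eq_iff)
  ultimately show ?thesis
    by (simp add: matrix_vector_mult_basis column_def subst_matrix_def)
      (simp add: abelianization_def)
qed

lemma abelianization_subst_word:
  assumes "compatible \<theta>" "w \<in> set_pmf (subst_word \<theta> u)"
  shows "abelianization w = subst_matrix \<theta> *v abelianization u"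
  using assms(2)
proof (induction u arbitrary: w)
  case (Cons a u)
  then obtain v w' where "v \<in> set_pmf (\<theta> a)" "w' \<in> set_pmf (subst_word \<theta> u)" "w = v @ w'"
    by auto
  then show ?case
    using Cons.IH[of w'] abelianization_subst_letter[OF assms(1), of v a]
    by (subst abelianization_Cons) (simp add: matrix_vector_right_distrib)
qed auto

lemma abelianization_subst_iter:
  assumes "compatible \<theta>" "w \<in> set_pmf (subst_iter \<theta> k u)"
  shows "abelianization w = ((*v) (subst_matrix \<theta>) ^^ k) (abelianization u)"
  using assms(2) by (induction k arbitrary: w) (auto simp: abelianization_subst_word[OF assms(1)])

text \<open>The length of a word is the sum of the entries of its abelianization, which is the same for all
  words in the support. Hence the description that defines \<open>iter_length\<close> is met by the length of any of them.\<close>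

lemma length_subst_iter:
  assumes "compatible \<theta>" "w \<in> set_pmf (subst_iter \<theta> k u)"
  shows "length w = iter_length \<theta> k u"
proof -
  have eq: "length x = length w" if "x \<in> set_pmf (subst_iter \<theta> k u)" for x
  proof -
    have "real (length x) = real (length w)"
      unfolding length_abelianization
      using abelianization_subst_iter[OF assms(1) that] abelianization_subst_iter[OF assms] by simp
    then show ?thesis by simp
  qed
  show ?thesis
    unfolding iter_length_def
  proof (rule the_equality[symmetric])
    show "l = length w" if "\<forall>u\<in>set_pmf (subst_iter \<theta> k u). length u = l" for l
      using that assms(2) by metis
  qed (use eq in blast)
qed

lemma subst_word_append:
  "subst_word \<theta> (u @ v) =
     bind_pmf (subst_word \<theta> u) (\<lambda>x. bind_pmf (subst_word \<theta> v) (\<lambda>y. return_pmf (x @ y)))"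
  by (induction u) (simp_all add: bind_return_pmf bind_return_pmf' bind_assoc_pmf)

text \<open>Substituting twice is the same as substituting once with the composed random substitution: the
  images of different letters are independent, so the two rounds may be carried out letter by letter.\<close>

lemma bind_subst_word:
  "bind_pmf (subst_word \<theta> u) (subst_word \<eta>) = subst_word (\<lambda>a. bind_pmf (\<theta> a) (subst_word \<eta>)) u"
proof (induction u)
  case (Cons a u)
  have "bind_pmf (subst_word \<theta> (a # u)) (subst_word \<eta>)
      = bind_pmf (\<theta> a) (\<lambda>v. bind_pmf (subst_word \<theta> u) (\<lambda>w.
          bind_pmf (subst_word \<eta> v) (\<lambda>x. bind_pmf (subst_word \<eta> w) (\<lambda>y. return_pmf (x @ y)))))"
    by (simp add: bind_assoc_pmf bind_return_pmf subst_word_append)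
  also have "\<dots> = bind_pmf (\<theta> a) (\<lambda>v. bind_pmf (subst_word \<eta> v) (\<lambda>x.
          bind_pmf (subst_word \<theta> u) (\<lambda>w. bind_pmf (subst_word \<eta> w) (\<lambda>y. return_pmf (x @ y)))))"
    by (subst bind_commute_pmf) simp
  also have "\<dots> = subst_word (\<lambda>a. bind_pmf (\<theta> a) (subst_word \<eta>)) (a # u)"
    by (simp add: bind_assoc_pmf Cons.IH[symmetric])
  finally show ?case .
qed (simp add: bind_return_pmf)

text \<open>The \<open>k\<close>-th power is itself a random substitution, so that statements about one inflation step apply to
  \<open>k\<close> steps at once.\<close>

definition subst_power :: "('a \<Rightarrow> 'a list pmf) \<Rightarrow> nat \<Rightarrow> 'a \<Rightarrow> 'a list pmf" where
  "subst_power \<theta> k a = subst_iter \<theta> k [a]"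

lemma subst_iter_eq_subst_word: "subst_iter \<theta> k u = subst_word (subst_power \<theta> k) u"
proof (induction k arbitrary: u)
  case 0
  have "subst_word (\<lambda>a. return_pmf [a]) u = return_pmf u"
    by (induction u) (simp_all add: bind_return_pmf)
  moreover have "subst_power \<theta> 0 = (\<lambda>a. return_pmf [a])"
    by (simp add: subst_power_def fun_eq_iff)
  ultimately show ?case by simp
next
  case (Suc k)
  have "subst_power \<theta> (Suc k) = (\<lambda>a. bind_pmf (subst_power \<theta> k a) (subst_word \<theta>))"
    by (simp add: subst_power_def fun_eq_iff)
  then show ?case by (simp add: Suc bind_subst_word)
qed

lemma finite_set_subst_word:
  "random_substitution \<theta> \<Longrightarrow> finite (set_pmf (subst_word \<theta> u))"
  by (induction u) (auto simp: random_substitution_def)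

lemma length_subst_word_ge:
  assumes "random_substitution \<theta>" "w \<in> set_pmf (subst_word \<theta> u)"
  shows "length u \<le> length w"
  using assms(2)
proof (induction u arbitrary: w)
  case (Cons a u)
  then obtain v w' where *: "v \<in> set_pmf (\<theta> a)" "w' \<in> set_pmf (subst_word \<theta> u)" "w = v @ w'"
    by auto
  moreover have "v \<noteq> []" using assms(1) *(1) by (auto simp: random_substitution_def)
  then have "0 < length v" by simp
  ultimately show ?case using Cons.IH[of w'] by (simp del: length_greater_0_conv)
qed auto

lemma random_substitution_power:
  assumes "random_substitution \<theta>"
  shows "random_substitution (subst_power \<theta> k)"
proof (induction k)
  case 0
  then show ?case by (simp add: random_substitution_def subst_power_def)
next
  case (Suc k)
  have eq: "subst_power \<theta> (Suc k) a = bind_pmf (subst_power \<theta> k a) (subst_word \<theta>)" for a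
    by (simp add: subst_power_def)
  have "v \<noteq> []" if "u \<in> set_pmf (subst_power \<theta> k a)" "v \<in> set_pmf (subst_word \<theta> u)" for a u v
  proof -
    have "u \<noteq> []" using Suc that(1) by (auto simp: random_substitution_def)
    then show ?thesis using length_subst_word_ge[OF assms that(2)] by auto
  qed
  then show ?case
    unfolding random_substitution_def eq
    using Suc finite_set_subst_word[OF assms] by (auto simp: random_substitution_def)
qed

lemma language_sublist:
  assumes "u \<in> language \<theta>" "sublist v u"
  shows "v \<in> language \<theta>"
proof -
  obtain a k w where "w \<in> set_pmf (subst_iter \<theta> k [a])" "sublist u w"
    using assms(1) unfolding language_def by blast
  moreover from this have "sublist v w"
    using assms(2) sublist_order.order_trans by blast
  ultimately show ?thesis unfolding language_def by blast
qed

lemma language_take: "u \<in> language \<theta> \<Longrightarrow> take m u \<in> language \<theta>"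
  by (rule language_sublist) auto

lemma subst_power_language: "u \<in> set_pmf (subst_power \<theta> k a) \<Longrightarrow> u \<in> language \<theta>"
  unfolding language_def subst_power_def by auto

lemma language_subst_word:
  assumes "u \<in> language \<theta>" "w \<in> set_pmf (subst_word \<theta> u)"
  shows "w \<in> language \<theta>"
proof -
  obtain a k x y where "x @ u @ y \<in> set_pmf (subst_iter \<theta> k [a])"
    using assms(1) unfolding language_def sublist_def by auto
  moreover obtain x' where x': "x' \<in> set_pmf (subst_word \<theta> x)"
    by (metis ex_in_conv set_pmf_not_empty)
  moreover obtain y' where y': "y' \<in> set_pmf (subst_word \<theta> y)"
    by (metis ex_in_conv set_pmf_not_empty)
  have "w @ y' \<in> set_pmf (subst_word \<theta> (u @ y))"
    unfolding subst_word_append using assms(2) y' by auto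
  then have "x' @ w @ y' \<in> set_pmf (subst_word \<theta> (x @ u @ y))"
    unfolding subst_word_append[of _ x] using x' by auto
  ultimately have "x' @ w @ y' \<in> set_pmf (subst_iter \<theta> (Suc k) [a])" by auto
  then show ?thesis unfolding language_def by (blast intro: sublist_appendI)
qed

text \<open>A prefix of an inflated word is an inflated prefix followed by a part of the inflation of one letter.
  Past the end the part is empty, and the letter is arbitrary.\<close>

lemma take_subst_word_split:
  assumes "w \<in> set_pmf (subst_word \<theta> u)"
  shows "\<exists>i b v l w'. w' \<in> set_pmf (subst_word \<theta> (take i u)) \<and> v \<in> set_pmf (\<theta> b) \<and>
           take m w = w' @ take l v"
  using assms
proof (induction u arbitrary: w m)
  case Nil
  obtain b v where "v \<in> set_pmf (\<theta> b)" by (metis ex_in_conv set_pmf_not_empty)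
  with Nil show ?case by (intro exI[of _ 0] exI[of _ b] exI[of _ v] exI[of _ "[]"]) auto
next
  case (Cons a u)
  then obtain v w1 where *: "v \<in> set_pmf (\<theta> a)" "w1 \<in> set_pmf (subst_word \<theta> u)" "w = v @ w1"
    by auto
  show ?case
  proof (cases "m \<le> length v")
    case True
    then show ?thesis
      using * by (intro exI[of _ 0] exI[of _ a] exI[of _ v] exI[of _ m] exI[of _ "[]"]) auto
  next
    case False
    obtain i b v' l w' where "w' \<in> set_pmf (subst_word \<theta> (take i u))" "v' \<in> set_pmf (\<theta> b)"
      "take (m - length v) w1 = w' @ take l v'"
      using Cons.IH[OF *(2)] by blast
    then show ?thesis
      using * False
      by (intro exI[of _ "Suc i"] exI[of _ b] exI[of _ v'] exI[of _ l] exI[of _ "v @ w'"]) auto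
  qed
qed

section \<open>Boundedness of the projection on the language\<close>

lemma pf_proj_linear: "linear (pf_proj L R)"
  by (rule linearI) (simp_all add: pf_proj_def inner_add_right algebra_simps)

lemma pf_proj_hyperplane: "L \<bullet> R = 1 \<Longrightarrow> L \<bullet> pf_proj L R x = 0"
  by (simp add: pf_proj_def inner_diff_right)

lemma pf_proj_subst_matrix:
  assumes "pf_eigenvectors \<theta> L R"
  shows "pf_proj L R (subst_matrix \<theta> *v x) = subst_matrix \<theta> *v pf_proj L R x"
proof -
  have "L \<bullet> (subst_matrix \<theta> *v x) = pf_eigenvalue \<theta> * (L \<bullet> x)"
    using assms by (simp add: pf_eigenvectors_def flip: dot_lmul_matrix)
  moreover have "subst_matrix \<theta> *v ((L \<bullet> x) *\<^sub>R R) = (L \<bullet> x) *\<^sub>R (pf_eigenvalue \<theta> *\<^sub>R R)"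
    using assms by (simp add: pf_eigenvectors_def matrix_vector_mult_scaleR)
  ultimately show ?thesis
    by (simp add: pf_proj_def matrix_vector_mult_diff_distrib mult.commute)
qed

lemma pf_proj_matrix_iter:
  assumes "pf_eigenvectors \<theta> L R"
  shows "pf_proj L R (((*v) (subst_matrix \<theta>) ^^ k) x) = ((*v) (subst_matrix \<theta>) ^^ k) (pf_proj L R x)"
  by (induction k) (simp_all add: pf_proj_subst_matrix[OF assms])

lemma linear_matrix_iter:
  fixes M :: "real^'n^'n"
  shows "linear ((*v) M ^^ k)"
proof (induction k)
  case 0
  then show ?case by (simp add: linear_iff)
next
  case (Suc k)
  show ?case
    unfolding funpow.simps by (rule linear_compose[OF Suc matrix_vector_mul_linear])
qed

text \<open>Summability of the single orbits becomes uniform by expanding \<open>x\<close> in the projected basis vectors.\<close>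

lemma contraction_on_hyperplane:
  assumes irr: "irreducible_pisot \<theta>" and ev: "pf_eigenvectors \<theta> L R"
  obtains c :: "nat \<Rightarrow> real" where "summable c" "\<And>k. 0 \<le> c k"
    "\<And>k x. L \<bullet> x = 0 \<Longrightarrow> norm (((*v) (subst_matrix \<theta>) ^^ k) x) \<le> c k * norm x"
proof
  let ?A = "\<lambda>k. (*v) (subst_matrix \<theta> :: real^'a^'a) ^^ k"
  let ?e = "\<lambda>i. pf_proj L R (axis i 1)"
  define c where "c = (\<lambda>k. \<Sum>i\<in>UNIV. norm (?A k (?e i)))"
  have LR: "L \<bullet> R = 1" using ev by (simp add: pf_eigenvectors_def)
  show "summable c"
    unfolding c_def
    by (intro summable_sum irreducible_pisot_summable_orbit[OF irr ev] pf_proj_hyperplane LR)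
  show "0 \<le> c k" for k by (simp add: c_def sum_nonneg)
  show "norm (?A k x) \<le> c k * norm x" if "L \<bullet> x = 0" for k x
  proof -
    have "x = pf_proj L R x" using that by (simp add: pf_proj_def)
    also have "\<dots> = pf_proj L R (\<Sum>i\<in>UNIV. x $ i *\<^sub>R axis i 1)"
      using basis_expansion[of x] by (simp only: scalar_mult_eq_scaleR)
    also have "\<dots> = (\<Sum>i\<in>UNIV. x $ i *\<^sub>R ?e i)"
      by (simp add: linear_sum[OF pf_proj_linear] linear_cmul[OF pf_proj_linear])
    finally have "?A k x = ?A k (\<Sum>i\<in>UNIV. x $ i *\<^sub>R ?e i)"
      by (rule arg_cong)
    also have "\<dots> = (\<Sum>i\<in>UNIV. x $ i *\<^sub>R ?A k (?e i))"
      by (simp only: linear_sum[OF linear_matrix_iter] linear_cmul[OF linear_matrix_iter])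
    also have "norm \<dots> \<le> (\<Sum>i\<in>UNIV. norm x * norm (?A k (?e i)))"
      by (intro sum_norm_le) (simp add: mult_right_mono component_le_norm_cart)
    also have "\<dots> = c k * norm x"
      by (simp add: c_def mult.commute flip: sum_distrib_left)
    finally show ?thesis .
  qed
qed

text \<open>Iterating \<open>take_subst_word_split\<close> through the levels of inflation, a prefix collects at each level \<open>j\<close> a
  short word which is then inflated \<open>j\<close> times. This is the Dumont--Thomas expansion of the prefix.\<close>

lemma prefix_projection_expansion:
  assumes comp: "compatible \<theta>" and ev: "pf_eigenvectors \<theta> L R"
    and B: "\<And>b v l. v \<in> set_pmf (\<theta> b) \<or> v = [b] \<Longrightarrow>
              norm (pf_proj L R (abelianization (take l v))) \<le> B"
    and w: "w \<in> set_pmf (subst_iter \<theta> k [a])"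
  shows "\<exists>h. (\<forall>j. L \<bullet> h j = 0 \<and> norm (h j) \<le> B) \<and>
           pf_proj L R (abelianization (take m w)) =
             (\<Sum>j<Suc k. ((*v) (subst_matrix \<theta>) ^^ j) (h j))"
  using w
proof (induction k arbitrary: w m)
  case 0
  have LR: "L \<bullet> R = 1" using ev by (simp add: pf_eigenvectors_def)
  show ?case
    by (rule exI[of _ "\<lambda>_. pf_proj L R (abelianization (take m w))"])
      (use 0 B[of "[a]" a m] pf_proj_hyperplane[OF LR] in auto)
next
  case (Suc k)
  have LR: "L \<bullet> R = 1" using ev by (simp add: pf_eigenvectors_def)
  let ?M = "subst_matrix \<theta> :: real^'a^'a"
  obtain u where u: "u \<in> set_pmf (subst_iter \<theta> k [a])" "w \<in> set_pmf (subst_word \<theta> u)"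
    using Suc.prems by auto
  obtain i b v l w' where w': "w' \<in> set_pmf (subst_word \<theta> (take i u))" and v: "v \<in> set_pmf (\<theta> b)"
    and split: "take m w = w' @ take l v"
    using take_subst_word_split[OF u(2)] by blast
  obtain h where h: "\<And>j. L \<bullet> h j = 0" "\<And>j. norm (h j) \<le> B"
    and eq: "pf_proj L R (abelianization (take i u)) = (\<Sum>j<Suc k. ((*v) ?M ^^ j) (h j))"
    using Suc.IH[OF u(1)] by blast
  define q where "q = pf_proj L R (abelianization (take l v))"
  define h' where "h' = (\<lambda>j. case j of 0 \<Rightarrow> q | Suc j \<Rightarrow> h j)"
  have "pf_proj L R (abelianization (take m w)) = ?M *v pf_proj L R (abelianization (take i u)) + q"
    by (simp add: split q_def abelianization_subst_word[OF comp w'] linear_add[OF pf_proj_linear]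
        pf_proj_subst_matrix[OF ev])
  also have "?M *v pf_proj L R (abelianization (take i u)) = (\<Sum>j<Suc k. ((*v) ?M ^^ Suc j) (h j))"
    unfolding eq by (simp add: linear_sum[OF matrix_vector_mul_linear] matrix_vector_right_distrib)
  also have "\<dots> + q = (\<Sum>j<Suc (Suc k). ((*v) ?M ^^ j) (h' j))"
    by (subst (2) sum.lessThan_Suc_shift) (simp add: h'_def)
  finally have "pf_proj L R (abelianization (take m w)) = (\<Sum>j<Suc (Suc k). ((*v) ?M ^^ j) (h' j))" .
  moreover have "L \<bullet> h' j = 0 \<and> norm (h' j) \<le> B" for j
    using h B[of v b l] v pf_proj_hyperplane[OF LR] by (auto simp: h'_def q_def split: nat.split)
  ultimately show ?case by blast
qed

text \<open>A legal word is the difference of two prefixes of an inflated letter, and for prefixes the expansion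
  is dominated by the summable contraction constants.\<close>

lemma language_projection_bounded:
  assumes rs: "random_substitution \<theta>" and comp: "compatible \<theta>"
    and irr: "irreducible_pisot \<theta>" and ev: "pf_eigenvectors \<theta> L R"
  obtains C where "0 < C" "\<And>u. u \<in> language \<theta> \<Longrightarrow> norm (pf_proj L R (abelianization u)) \<le> C"
proof -
  obtain c :: "nat \<Rightarrow> real" where c: "summable c" "\<And>k. 0 \<le> c k"
    and contr: "\<And>k x. L \<bullet> x = 0 \<Longrightarrow> norm (((*v) (subst_matrix \<theta>) ^^ k) x) \<le> c k * norm x"
    using contraction_on_hyperplane[OF irr ev] by blast
  let ?F = "(\<Union>b. set_pmf (\<theta> b) \<union> {[b]})"
  let ?T = "(\<lambda>v. pf_proj L R (abelianization v)) ` (\<Union>v\<in>?F. (\<lambda>l. take l v) ` {..length v})"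
  have "finite ?T"
    using rs by (auto simp: random_substitution_def)
  then obtain B where B: "\<And>x. x \<in> ?T \<Longrightarrow> norm x \<le> B"
    by (meson bounded_iff finite_imp_bounded)
  have B': "norm (pf_proj L R (abelianization (take l v))) \<le> B"
    if "v \<in> set_pmf (\<theta> b) \<or> v = [b]" for b v l
  proof (rule B, rule imageI)
    have eq: "take l v = take (min l (length v)) v" by (simp add: min_def)
    have "v \<in> ?F" using that by blast
    moreover have "take l v \<in> (\<lambda>l. take l v) ` {..length v}"
      by (rule image_eqI, rule eq) simp
    ultimately show "take l v \<in> (\<Union>v\<in>?F. (\<lambda>l. take l v) ` {..length v})"
      by (rule UN_I)
  qed
  have "0 \<le> B" using B'[of "[undefined]" undefined 0] by (meson norm_ge_zero order_trans)
  define D where "D = suminf c * B"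
  have D: "norm (pf_proj L R (abelianization (take m w))) \<le> D"
    if w: "w \<in> set_pmf (subst_iter \<theta> k [a])" for k a w m
  proof -
    have "\<exists>h. (\<forall>j. L \<bullet> h j = 0 \<and> norm (h j) \<le> B) \<and> pf_proj L R (abelianization (take m w))
        = (\<Sum>j<Suc k. ((*v) (subst_matrix \<theta>) ^^ j) (h j))"
      by (rule prefix_projection_expansion[OF comp ev _ w]) (rule B')
    then obtain h where h: "\<And>j. L \<bullet> h j = 0" "\<And>j. norm (h j) \<le> B"
      and eq: "pf_proj L R (abelianization (take m w)) = (\<Sum>j<Suc k. ((*v) (subst_matrix \<theta>) ^^ j) (h j))"
      by blast
    have "norm (pf_proj L R (abelianization (take m w))) \<le> (\<Sum>j<Suc k. c j * B)"
      unfolding eq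
    proof (rule sum_norm_le)
      fix j
      show "norm (((*v) (subst_matrix \<theta>) ^^ j) (h j)) \<le> c j * B"
        using contr[OF h(1), of j j] mult_left_mono[OF h(2)[of j] c(2)[of j]] by linarith
    qed
    also have "\<dots> = (\<Sum>j<Suc k. c j) * B" by (simp only: sum_distrib_right)
    also have "\<dots> \<le> D"
      unfolding D_def
      by (intro mult_right_mono sum_le_suminf) (use c \<open>0 \<le> B\<close> in auto)
    finally show ?thesis .
  qed
  \<comment> \<open>The summand 1 only serves to make the bound strictly positive.\<close>
  have "norm (pf_proj L R (abelianization u)) \<le> 2 * D + 1" if u: "u \<in> language \<theta>" for u
  proof -
    obtain a k x y where w: "x @ u @ y \<in> set_pmf (subst_iter \<theta> k [a])"
      using u unfolding language_def sublist_def by auto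
    define p where "p = pf_proj L R (abelianization (take (length x + length u) (x @ u @ y)))"
    define q where "q = pf_proj L R (abelianization (take (length x) (x @ u @ y)))"
    have "pf_proj L R (abelianization u) = p - q"
      by (simp add: p_def q_def linear_add[OF pf_proj_linear])
    moreover have "norm p \<le> D" "norm q \<le> D"
      unfolding p_def q_def by (rule D[OF w])+
    ultimately show ?thesis using norm_triangle_ineq4[of p q] by simp
  qed
  moreover have "0 \<le> D"
    unfolding D_def using suminf_nonneg[OF c] \<open>0 \<le> B\<close> by simp
  ultimately show ?thesis using that[of "2 * D + 1"] by simp
qed



section \<open>Concentration of block frequencies\<close>

text \<open>As \<open>subst_word\<close>, but the images of the letters are kept apart: the concatenated word alone does not
  determine where the blocks begin.\<close>

primrec subst_blocks :: "('a \<Rightarrow> 'a list pmf) \<Rightarrow> 'a list \<Rightarrow> 'a list list pmf" where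
  "subst_blocks \<theta> [] = return_pmf []"
| "subst_blocks \<theta> (i # u) =
     bind_pmf (\<theta> i) (\<lambda>v. bind_pmf (subst_blocks \<theta> u) (\<lambda>ws. return_pmf (v # ws)))"

lemma subst_word_blocks: "subst_word \<theta> u = map_pmf concat (subst_blocks \<theta> u)"
  by (induction u) (simp_all add: map_bind_pmf bind_map_pmf bind_return_pmf)

lemma subst_blocks_support:
  "ws \<in> set_pmf (subst_blocks \<theta> u) \<longleftrightarrow> list_all2 (\<lambda>w a. w \<in> set_pmf (\<theta> a)) ws u"
  by (induction u arbitrary: ws) (auto simp: list_all2_Cons2)

text \<open>The number of occurrences of the block \<open>u\<close> minus its expectation given the letters that are inflated.\<close>

fun block_deviation :: "('a \<Rightarrow> 'a list pmf) \<Rightarrow> 'a list \<Rightarrow> 'a list \<Rightarrow> 'a list list \<Rightarrow> real" where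
  "block_deviation \<theta> u (a # v) (w # ws) =
     of_bool (w = u) - pmf (\<theta> a) u + block_deviation \<theta> u v ws"
| "block_deviation \<theta> u _ _ = 0"

text \<open>Hoeffding's lemma; the sign \<open>s\<close> covers both tails.\<close>

lemma letter_deviation_mgf:
  fixes p :: "'b pmf"
  assumes "s \<in> {1, -1}" "0 < t"
  shows "(\<integral>\<^sup>+ w. ennreal (exp (t * (s * (of_bool (w = u) - pmf p u)))) \<partial>measure_pmf p)
           \<le> ennreal (exp (t\<^sup>2 / 2))"
proof -
  let ?f = "\<lambda>w. s * of_bool (w = u)"
  interpret interval_bounded_random_variable "measure_pmf p" ?f "-1" "1"
    by unfold_locales (use assms(1) in auto)
  have "(\<integral>w. (of_bool (w = u) :: real) \<partial>measure_pmf p) = (\<integral>w. indicator {u} w \<partial>measure_pmf p)"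
    by (rule Bochner_Integration.integral_cong) (auto simp: indicator_def)
  then have E: "(\<integral>w. (of_bool (w = u) :: real) \<partial>measure_pmf p) = pmf p u"
    by (simp add: measure_pmf_single)
  show ?thesis
    using Hoeffdings_lemma_nn_integral[OF assms(2)] by (simp add: right_diff_distrib E)
qed

text \<open>By independence of the blocks, the moment generating function is a product over the letters.\<close>

lemma block_deviation_mgf:
  assumes "s \<in> {1, -1}" "0 < t"
  shows "(\<integral>\<^sup>+ ws. ennreal (exp (t * (s * block_deviation \<theta> u v ws))) \<partial>measure_pmf (subst_blocks \<theta> v))
           \<le> ennreal (exp (t\<^sup>2 / 2 * real (length v)))"
proof (induction v)
  case (Cons a v)
  let ?g = "\<lambda>ws. ennreal (exp (t * (s * block_deviation \<theta> u v ws)))"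
  let ?h = "\<lambda>w. ennreal (exp (t * (s * (of_bool (w = u) - pmf (\<theta> a) u))))"
  have "(\<integral>\<^sup>+ ws. ennreal (exp (t * (s * block_deviation \<theta> u (a # v) ws)))
          \<partial>measure_pmf (subst_blocks \<theta> (a # v)))
      = (\<integral>\<^sup>+ w. (\<integral>\<^sup>+ ws. ?h w * ?g ws \<partial>measure_pmf (subst_blocks \<theta> v)) \<partial>measure_pmf (\<theta> a))"
    by (simp add: distrib_left exp_add ennreal_mult)
  also have "\<dots> = (\<integral>\<^sup>+ w. ?h w \<partial>measure_pmf (\<theta> a)) * (\<integral>\<^sup>+ ws. ?g ws \<partial>measure_pmf (subst_blocks \<theta> v))"
    by (simp add: nn_integral_cmult nn_integral_multc)
  also have "\<dots> \<le> ennreal (exp (t\<^sup>2 / 2)) * ennreal (exp (t\<^sup>2 / 2 * real (length v)))"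
    by (intro mult_mono letter_deviation_mgf[OF assms] Cons.IH) auto
  also have "\<dots> = ennreal (exp (t\<^sup>2 / 2 * real (length (a # v))))"
    by (simp add: distrib_left flip: ennreal_mult exp_add)
  finally show ?case .
qed (simp add: nn_integral_return_pmf)

text \<open>The Chernoff bound, with the parameter \<open>e\<close> that is optimal for this moment generating function.\<close>

lemma block_deviation_tail:
  assumes s: "s \<in> {1, -1}" and "0 < e"
  shows "emeasure (measure_pmf (subst_blocks \<theta> v)) {ws. e * real (length v) < s * block_deviation \<theta> u v ws}
           \<le> ennreal (exp (- (e\<^sup>2 / 2 * real (length v))))"
proof -
  let ?N = "real (length v)"
  let ?D = "\<lambda>ws. s * block_deviation \<theta> u v ws"
  have "emeasure (measure_pmf (subst_blocks \<theta> v)) {ws. e * ?N < ?D ws}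
      \<le> (\<integral>\<^sup>+ ws. ennreal (exp (- (e\<^sup>2 * ?N))) * ennreal (exp (e * ?D ws)) \<partial>measure_pmf (subst_blocks \<theta> v))"
  proof (subst nn_integral_indicator[symmetric], simp, rule nn_integral_mono)
    fix ws
    have "1 \<le> exp (- (e\<^sup>2 * ?N)) * exp (e * ?D ws)" if "e * ?N < ?D ws"
      using mult_strict_left_mono[OF that \<open>0 < e\<close>]
      by (simp add: power2_eq_square mult_ac flip: exp_add)
    then show "indicator {ws. e * ?N < ?D ws} ws
        \<le> ennreal (exp (- (e\<^sup>2 * ?N))) * ennreal (exp (e * ?D ws))"
      by (auto simp: indicator_def simp flip: ennreal_mult)
  qed
  also have "\<dots> = ennreal (exp (- (e\<^sup>2 * ?N)))
      * (\<integral>\<^sup>+ ws. ennreal (exp (e * ?D ws)) \<partial>measure_pmf (subst_blocks \<theta> v))"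
    by (simp add: nn_integral_cmult)
  also have "\<dots> \<le> ennreal (exp (- (e\<^sup>2 * ?N))) * ennreal (exp (e\<^sup>2 / 2 * ?N))"
    by (intro mult_left_mono block_deviation_mgf[OF assms]) auto
  also have "\<dots> = ennreal (exp (- (e\<^sup>2 / 2 * ?N)))"
    by (simp add: field_simps flip: ennreal_mult exp_add)
  finally show ?thesis .
qed

definition balanced_blocks :: "('a \<Rightarrow> 'a list pmf) \<Rightarrow> real \<Rightarrow> 'a list \<Rightarrow> 'a list list \<Rightarrow> bool" where
  "balanced_blocks \<theta> e v ws \<longleftrightarrow>
     (\<forall>u\<in>(\<Union>b. set_pmf (\<theta> b)). \<bar>block_deviation \<theta> u v ws\<bar> \<le> e * real (length v))"

lemma finite_block_alphabet:
  fixes \<theta> :: "'a::finite \<Rightarrow> 'a list pmf"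
  shows "random_substitution \<theta> \<Longrightarrow> finite (\<Union>b. set_pmf (\<theta> b))"
  by (auto simp: random_substitution_def)

lemma unbalanced_blocks_prob:
  fixes \<theta> :: "'a::finite \<Rightarrow> 'a list pmf"
  assumes rs: "random_substitution \<theta>" and "0 < e"
  shows "emeasure (measure_pmf (subst_blocks \<theta> v)) {ws. \<not> balanced_blocks \<theta> e v ws}
           \<le> ennreal (2 * real (card (\<Union>b. set_pmf (\<theta> b))) * exp (- (e\<^sup>2 / 2 * real (length v))))"
proof -
  let ?U = "\<Union>b. set_pmf (\<theta> b)"
  let ?P = "emeasure (measure_pmf (subst_blocks \<theta> v))"
  let ?x = "exp (- (e\<^sup>2 / 2 * real (length v)))"
  let ?A = "\<lambda>s u. {ws. e * real (length v) < s * block_deviation \<theta> u v ws}"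
  have U: "finite ?U" by (rule finite_block_alphabet[OF rs])
  have "{ws. \<not> balanced_blocks \<theta> e v ws} \<subseteq> (\<Union>u\<in>?U. ?A 1 u \<union> ?A (-1) u)"
    by (force simp: balanced_blocks_def abs_if not_le split: if_splits)
  then have "?P {ws. \<not> balanced_blocks \<theta> e v ws} \<le> ?P (\<Union>u\<in>?U. ?A 1 u \<union> ?A (-1) u)"
    by (rule emeasure_mono) simp
  also have "\<dots> \<le> (\<Sum>u\<in>?U. ?P (?A 1 u \<union> ?A (-1) u))"
    by (rule emeasure_subadditive_finite[OF U]) auto
  also have "\<dots> \<le> (\<Sum>u\<in>?U. ennreal (2 * ?x))"
  proof (rule sum_mono)
    fix u
    have "?P (?A 1 u \<union> ?A (-1) u) \<le> ?P (?A 1 u) + ?P (?A (-1) u)"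
      by (rule emeasure_subadditive) auto
    also have "\<dots> \<le> ennreal ?x + ennreal ?x"
      by (intro add_mono block_deviation_tail[OF _ \<open>0 < e\<close>]) auto
    finally show "?P (?A 1 u \<union> ?A (-1) u) \<le> ennreal (2 * ?x)"
      by (simp flip: ennreal_plus)
  qed
  also have "\<dots> = ennreal (2 * real (card ?U) * ?x)"
    by (simp add: ennreal_of_nat_eq_real_of_nat mult_ac flip: ennreal_mult)
  finally show ?thesis .
qed

text \<open>The cut after the last complete block within the first \<open>n\<close> letters.\<close>

lemma block_cut:
  fixes len :: "'a \<Rightarrow> nat"
  assumes "\<And>b. 0 < len b" "\<And>b. len b \<le> K" "n \<le> length v" "0 < K"
  shows "\<exists>m\<le>length v. sum_list (map len (take m v)) \<le> n \<and> n < sum_list (map len (take m v)) + K"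
  using assms(3)
proof (induction v arbitrary: n)
  case (Cons a v)
  show ?case
  proof (cases "n < len a")
    case True
    then show ?thesis using assms(2)[of a] by (intro exI[of _ 0]) auto
  next
    case False
    then have "n - len a \<le> length v" using Cons.prems assms(1)[of a] by auto
    from Cons.IH[OF this] obtain m where "m \<le> length v"
      "sum_list (map len (take m v)) \<le> n - len a" "n - len a < sum_list (map len (take m v)) + K"
      by blast
    then show ?thesis using False by (intro exI[of _ "Suc m"]) auto
  qed
qed (use assms in auto)

text \<open>The remainder \<open>r\<close> collects the letters of the block that is cut off.\<close>

definition balanced_parse ::
    "('a \<Rightarrow> 'a list pmf) \<Rightarrow> 'a list set \<Rightarrow> nat \<Rightarrow> real \<Rightarrow> 'a list \<Rightarrow> bool" where
  "balanced_parse \<theta> Lang K e w \<longleftrightarrow>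
     (\<exists>v ws r. w = concat ws @ r \<and> length r \<le> K \<and> v \<in> Lang \<and>
        ws \<in> set_pmf (subst_blocks \<theta> v) \<and> balanced_blocks \<theta> e v ws)"

text \<open>Since block lengths are functions of the letters, the number \<open>m\<close> of complete blocks is determined by \<open>v\<close>. The
  event is thus controlled by the first \<open>m\<close> blocks, whose law is the one for the word \<open>take m v\<close>, and
  \<open>m\<close> is at least \<open>n / K - 1\<close>.\<close>

lemma unbalanced_parse_prob:
  fixes \<theta> :: "'a::finite \<Rightarrow> 'a list pmf"
  assumes rs: "random_substitution \<theta>" and "0 < e"
    and len: "\<And>b w. w \<in> set_pmf (\<theta> b) \<Longrightarrow> length w = len b" "\<And>b. len b \<le> K"
    and v: "\<And>m. take m v \<in> Lang" and n: "n \<le> length v"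
  shows "measure_pmf.prob (subst_word \<theta> v) {w. \<not> balanced_parse \<theta> Lang K e (take n w)}
           \<le> 2 * real (card (\<Union>b. set_pmf (\<theta> b))) * exp (- (e\<^sup>2 / 2 * (real n / real K - 1)))"
proof -
  have pos: "0 < len b" for b
  proof -
    obtain w where w: "w \<in> set_pmf (\<theta> b)" by (metis ex_in_conv set_pmf_not_empty)
    with rs have "w \<noteq> []" by (auto simp: random_substitution_def)
    with len(1)[OF w] show ?thesis by (metis length_greater_0_conv)
  qed
  have K: "0 < K" using pos[of undefined] len(2)[of undefined] by linarith
  obtain m where m: "m \<le> length v" "sum_list (map len (take m v)) \<le> n"
    "n < sum_list (map len (take m v)) + K"
    using block_cut[of len K n v, OF pos len(2) n K] by (elim exE conjE)
  let ?v = "take m v"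
  have "sum_list (map len u) \<le> length u * K" for u
  proof (induction u)
    case (Cons a u)
    then show ?case using len(2)[of a] by simp
  qed simp
  moreover have lv: "length ?v = m" using m(1) by simp
  ultimately have "n \<le> m * K + K" using m(3) by (metis add_le_mono1 less_imp_le order_trans)
  then have "real n \<le> real (m * K + K)" by (simp only: of_nat_le_iff)
  then have "real n \<le> real m * real K + real K" by simp
  then have mK: "real n / real K - 1 \<le> real m" using K by (simp add: field_simps)
  have good: "balanced_parse \<theta> Lang K e (take n (concat ws @ y))"
    if ws: "ws \<in> set_pmf (subst_blocks \<theta> ?v)" and bal: "balanced_blocks \<theta> e ?v ws" for ws y
  proof -
    have "length (concat ws) = sum_list (map len u)" if "ws \<in> set_pmf (subst_blocks \<theta> u)" for u
      using that unfolding subst_blocks_support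
    proof (induction rule: list_all2_induct)
      case (Cons x xs y ys)
      then show ?case using len(1)[of x y] by simp
    qed simp
    from this[OF ws] m(2,3) have l: "length (concat ws) \<le> n" "n - length (concat ws) \<le> K"
      by linarith+
    show ?thesis
      unfolding balanced_parse_def
    proof (intro exI conjI)
      show "take n (concat ws @ y) = concat ws @ take (n - length (concat ws)) y"
        using l(1) by (simp only: take_append take_all)
      show "length (take (n - length (concat ws)) y) \<le> K"
        using l(2) by (simp only: length_take min.coboundedI2)
    qed (rule v ws bal)+
  qed
  let ?B = "{w. \<not> balanced_parse \<theta> Lang K e (take n w)}"
  have "subst_word \<theta> v = bind_pmf (subst_word \<theta> ?v) (\<lambda>x. map_pmf (\<lambda>y. x @ y) (subst_word \<theta> (drop m v)))"
    using subst_word_append[of \<theta> ?v "drop m v"] by (simp only: append_take_drop_id map_pmf_def)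
  also have "\<dots> = bind_pmf (subst_blocks \<theta> ?v)
      (\<lambda>ws. map_pmf (\<lambda>y. concat ws @ y) (subst_word \<theta> (drop m v)))"
    by (simp only: subst_word_blocks[of \<theta> ?v] bind_map_pmf)
  finally have "emeasure (measure_pmf (subst_word \<theta> v)) ?B
      = (\<integral>\<^sup>+ ws. emeasure (measure_pmf (subst_word \<theta> (drop m v)))
           {y. \<not> balanced_parse \<theta> Lang K e (take n (concat ws @ y))} \<partial>measure_pmf (subst_blocks \<theta> ?v))"
    by (simp only: emeasure_bind_pmf emeasure_map_pmf vimage_Collect_eq)
  also have "\<dots> \<le> (\<integral>\<^sup>+ ws. indicator {ws. \<not> balanced_blocks \<theta> e ?v ws} ws \<partial>measure_pmf (subst_blocks \<theta> ?v))"
  proof (rule nn_integral_mono_AE, unfold AE_measure_pmf_iff, rule ballI)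
    fix ws assume ws: "ws \<in> set_pmf (subst_blocks \<theta> ?v)"
    show "emeasure (measure_pmf (subst_word \<theta> (drop m v)))
        {y. \<not> balanced_parse \<theta> Lang K e (take n (concat ws @ y))}
        \<le> indicator {ws. \<not> balanced_blocks \<theta> e ?v ws} ws"
    proof (cases "balanced_blocks \<theta> e ?v ws")
      case True
      then have "{y. \<not> balanced_parse \<theta> Lang K e (take n (concat ws @ y))} = {}"
        using good[OF ws] by blast
      then show ?thesis by (simp only: emeasure_empty zero_le)
    next
      case False
      then show ?thesis by (simp add: measure_pmf.emeasure_le_1)
    qed
  qed
  also have "\<dots> \<le> ennreal (2 * real (card (\<Union>b. set_pmf (\<theta> b))) * exp (- (e\<^sup>2 / 2 * real (length ?v))))"
    using unbalanced_blocks_prob[OF rs \<open>0 < e\<close>, of ?v]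
    by (simp only: nn_integral_indicator sets_measure_pmf UNIV_I)
  also have "\<dots> \<le> ennreal (2 * real (card (\<Union>b. set_pmf (\<theta> b))) * exp (- (e\<^sup>2 / 2 * (real n / real K - 1))))"
    unfolding lv using mK by (intro ennreal_leI mult_left_mono) (auto intro!: mult_left_mono)
  finally show ?thesis
    by (simp add: measure_pmf.emeasure_eq_measure)
qed



section \<open>Prefixes of sequences distributed by an invariant measure\<close>

lemma space_invariant_measure:
  assumes "sets \<nu> = sets (subshift_space \<theta>)"
  shows "space \<nu> = subshift \<theta>"
proof -
  have "space \<nu> = space (subshift_space \<theta>)"
    by (rule sets_eq_imp_space_eq[OF assms])
  then show ?thesis
    by (simp add: subshift_space_def space_restrict_space space_PiM)
qed

lemma measurable_prefix_seq:
  fixes \<nu> :: "(nat \<Rightarrow> 'a::finite) measure"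
  assumes "sets \<nu> = sets (subshift_space \<theta>)"
  shows "(\<lambda>x. prefix_seq x n) \<in> measurable \<nu> (count_space UNIV)"
proof -
  have coord: "(\<lambda>x. x i) \<in> measurable \<nu> (count_space UNIV)" for i
    unfolding measurable_cong_sets[OF assms refl] subshift_space_def
    by (intro measurable_restrict_space1 measurable_component_singleton) simp
  have "(\<lambda>x. prefix_seq x n) -` {w} \<inter> space \<nu> \<in> sets \<nu>" for w
  proof -
    have "(\<lambda>x. prefix_seq x n) -` {w} \<inter> space \<nu>
        = {x \<in> space \<nu>. length w = n \<and> (\<forall>i\<in>{..<n}. x i = w ! i)}"
    proof -
      have "prefix_seq x n = w \<longleftrightarrow> length w = n \<and> (\<forall>i\<in>{..<n}. x i = w ! i)" for x
      proof -
        have "prefix_seq x n = w \<longleftrightarrow> n = length w \<and> (\<forall>i<n. x i = w ! i)"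
          unfolding list_eq_iff_nth_eq prefix_seq_def by simp
        then show ?thesis by (simp only: lessThan_iff Ball_def eq_commute[of n])
      qed
      then show ?thesis by blast
    qed
    also have "\<dots> \<in> sets \<nu>"
    proof (intro sets.sets_Collect_conj sets.sets_Collect_const sets.sets_Collect_finite_All)
      fix i
      have "{x \<in> space \<nu>. x i = w ! i} = (\<lambda>x. x i) -` {w ! i} \<inter> space \<nu>" by blast
      also have "\<dots> \<in> sets \<nu>" by (rule measurable_sets[OF coord]) simp
      finally show "{x \<in> space \<nu>. x i = w ! i} \<in> sets \<nu>" .
    qed simp
    finally show ?thesis .
  qed
  then show ?thesis unfolding measurable_count_space_eq2_countable by blast
qed

lemma ex_pmf_of_discrete_measure:
  fixes M :: "'b::countable measure"
  assumes "prob_space M" and sets: "sets M = UNIV"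
  shows "\<exists>p. measure_pmf p = M"
proof -
  interpret prob_space M by fact
  have "AE x in M. \<forall>y. measure M {y} = 0 \<longrightarrow> x \<noteq> y"
  proof (unfold AE_all_countable, rule allI)
    fix y
    show "AE x in M. measure M {y} = 0 \<longrightarrow> x \<noteq> y"
    proof (cases "measure M {y} = 0")
      case True
      then have "{y} \<in> null_sets M"
        by (simp add: null_sets_def sets emeasure_eq_measure)
      from AE_not_in[OF this] show ?thesis by auto
    qed simp
  qed
  then have "AE x in M. measure M {x} \<noteq> 0" by eventually_elim auto
  then show ?thesis
    using assms Abs_pmf_inverse[of M] by blast
qed

text \<open>Passing from \<open>\<nu>\<close> to the mass function of the prefix of length \<open>n\<close> turns invariance into an equation in the
  monad of probability mass functions, where iterating it is plain rewriting.\<close>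

lemma ex_prefix_pmf:
  fixes \<theta> :: "'a::finite \<Rightarrow> 'a list pmf"
  assumes inv: "invariant_measure \<theta> \<nu>"
  obtains p where "\<And>A. measure \<nu> {x \<in> space \<nu>. prefix_seq x n \<in> A} = measure_pmf.prob p A"
    "set_pmf p \<subseteq> {v \<in> language \<theta>. length v = n}"
proof -
  have sets: "sets \<nu> = sets (subshift_space \<theta>)" and "prob_space \<nu>"
    using inv by (auto simp: invariant_measure_def)
  interpret prob_space \<nu> by fact
  note m = measurable_prefix_seq[OF sets, of n]
  let ?M = "distr \<nu> (count_space UNIV) (\<lambda>x. prefix_seq x n)"
  have "prob_space ?M" by (rule prob_space_distr[OF m])
  then obtain p where p: "measure_pmf p = ?M"
    using ex_pmf_of_discrete_measure[of ?M] by auto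
  have eq: "measure \<nu> {x \<in> space \<nu>. prefix_seq x n \<in> A} = measure_pmf.prob p A" for A
    unfolding p by (subst measure_distr[OF m]) (auto intro!: arg_cong[where f = "measure \<nu>"])
  let ?L = "{v \<in> language \<theta>. length v = n}"
  have empty: "{x \<in> space \<nu>. prefix_seq x n \<in> - ?L} = {}"
  proof -
    have "prefix_seq x n \<in> ?L" if "x \<in> subshift \<theta>" for x
      using that by (auto simp: subshift_def prefix_seq_def)
    then show ?thesis by (auto simp: space_invariant_measure[OF sets])
  qed
  then have "measure_pmf.prob p (- ?L) = 0" using eq[of "- ?L"] unfolding empty by simp
  then have "set_pmf p \<subseteq> ?L" unfolding measure_pmf_zero_iff by blast
  with eq show ?thesis by (rule that)
qed

text \<open>No letter has an empty image, so \<open>n\<close> letters inflate to at least \<open>n\<close> letters.\<close>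

lemma take_subst_word:
  assumes "random_substitution \<theta>"
  shows "map_pmf (take n) (subst_word \<theta> u) = map_pmf (take n) (subst_word \<theta> (take n u))"
proof (cases "length u \<le> n")
  case False
  have "map_pmf (take n) (subst_word \<theta> (take n u @ drop n u))
      = bind_pmf (subst_word \<theta> (take n u)) (\<lambda>x. map_pmf (\<lambda>y. take n (x @ y)) (subst_word \<theta> (drop n u)))"
    unfolding subst_word_append by (simp add: map_bind_pmf map_pmf_def bind_return_pmf bind_assoc_pmf)
  also have "\<dots> = bind_pmf (subst_word \<theta> (take n u)) (\<lambda>x. return_pmf (take n x))"
  proof (rule bind_pmf_cong[OF refl])
    fix x assume "x \<in> set_pmf (subst_word \<theta> (take n u))"
    from length_subst_word_ge[OF assms this] False have "n \<le> length x" by simp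
    then show "map_pmf (\<lambda>y. take n (x @ y)) (subst_word \<theta> (drop n u)) = return_pmf (take n x)"
      by simp
  qed
  also have "\<dots> = map_pmf (take n) (subst_word \<theta> (take n u))"
    by (simp add: map_pmf_def)
  finally show ?thesis by simp
qed simp

text \<open>On legal words of length \<open>n\<close> this is the definition of an invariant measure; elsewhere both sides vanish,
  as inflation preserves the language.\<close>

lemma prefix_pmf_invariant:
  fixes \<theta> :: "'a::finite \<Rightarrow> 'a list pmf"
  assumes rs: "random_substitution \<theta>" and inv: "invariant_measure \<theta> \<nu>"
    and p: "\<And>A. measure \<nu> {x \<in> space \<nu>. prefix_seq x n \<in> A} = measure_pmf.prob p A"
      "set_pmf p \<subseteq> {v \<in> language \<theta>. length v = n}"
  shows "bind_pmf p (\<lambda>v. map_pmf (take n) (subst_word \<theta> v)) = p"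
proof (rule pmf_eqI)
  fix w
  let ?L = "{v \<in> language \<theta>. length v = n}"
  let ?q = "bind_pmf p (\<lambda>v. map_pmf (take n) (subst_word \<theta> v))"
  have sets: "sets \<nu> = sets (subshift_space \<theta>)"
    using inv by (auto simp: invariant_measure_def)
  have cyl: "pmf p v = measure \<nu> (cylinder \<theta> v)" if "length v = n" for v
    using p(1)[of "{v}"] that
    by (simp add: cylinder_def space_invariant_measure[OF sets] measure_pmf_single)
  have fin: "finite ?L"
    by (rule finite_subset[OF _ finite_lists_length_eq[of UNIV n]]) auto
  show "pmf ?q w = pmf p w"
  proof (cases "w \<in> ?L")
    case True
    have "pmf ?q w = (\<Sum>v\<in>?L. pmf (map_pmf (take n) (subst_word \<theta> v)) w * pmf p v)"
      unfolding pmf_bind by (rule integral_measure_pmf_real[OF fin]) (use p(2) in auto)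
    also have "\<dots> = (\<Sum>v\<in>?L. measure \<nu> (cylinder \<theta> v) * measure_pmf.prob (subst_word \<theta> v) {u. take n u = w})"
      by (rule sum.cong[OF refl]) (auto simp: cyl pmf_map vimage_def)
    also have "\<dots> = measure \<nu> (cylinder \<theta> w)"
      using inv True by (simp add: invariant_measure_def)
    also have "\<dots> = pmf p w" using True cyl by simp
    finally show ?thesis .
  next
    case False
    have "set_pmf ?q \<subseteq> ?L"
    proof
      fix x assume "x \<in> set_pmf ?q"
      then obtain v u where "v \<in> set_pmf p" "u \<in> set_pmf (subst_word \<theta> v)" "x = take n u" by auto
      moreover from this have "v \<in> ?L" using p(2) by blast
      ultimately show "x \<in> ?L"
        using language_take[OF language_subst_word, of v \<theta> u n] length_subst_word_ge[OF rs, of u v]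
        by simp
    qed
    with False p(2) show ?thesis by (metis pmf_eq_0_set_pmf subset_iff)
  qed
qed

lemma prefix_pmf_invariant_iter:
  assumes rs: "random_substitution \<theta>"
    and p: "set_pmf p \<subseteq> {v. length v = n}"
    and inv: "bind_pmf p (\<lambda>v. map_pmf (take n) (subst_word \<theta> v)) = p"
  shows "bind_pmf p (\<lambda>v. map_pmf (take n) (subst_iter \<theta> k v)) = p"
proof (induction k)
  case 0
  have "map_pmf (take n) p = p"
    by (rule map_pmf_idI) (use p in auto)
  then show ?case by (simp add: map_pmf_def bind_return_pmf)
next
  case (Suc k)
  have "map_pmf (take n) (subst_iter \<theta> (Suc k) v)
      = bind_pmf (map_pmf (take n) (subst_iter \<theta> k v)) (\<lambda>u. map_pmf (take n) (subst_word \<theta> u))" for v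
    unfolding subst_iter.simps map_bind_pmf bind_map_pmf
    by (rule bind_pmf_cong[OF refl]) (rule take_subst_word[OF rs])
  then have "bind_pmf p (\<lambda>v. map_pmf (take n) (subst_iter \<theta> (Suc k) v))
      = bind_pmf (bind_pmf p (\<lambda>v. map_pmf (take n) (subst_iter \<theta> k v)))
          (\<lambda>u. map_pmf (take n) (subst_word \<theta> u))"
    by (simp only: bind_assoc_pmf)
  also have "\<dots> = p" by (simp only: Suc.IH inv)
  finally show ?case .
qed

text \<open>Invariance under the \<open>k\<close>-th power transfers the tail bound from inflated words to the prefixes of a
  \<open>\<nu>\<close>-random sequence. The bound is geometric in \<open>n\<close>, so the Borel--Cantelli lemma applies.\<close>

lemma AE_balanced_parse:
  fixes \<theta> :: "'a::finite \<Rightarrow> 'a list pmf"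
  assumes rs: "random_substitution \<theta>" and comp: "compatible \<theta>"
    and inv: "invariant_measure \<theta> \<nu>" and "0 < e"
    and K: "\<And>b. iter_length \<theta> k [b] \<le> K" "0 < K"
  shows "AE x in \<nu>. \<forall>\<^sub>F n in sequentially.
           balanced_parse (subst_power \<theta> k) (language \<theta>) K e (prefix_seq x n)"
proof -
  have sets: "sets \<nu> = sets (subshift_space \<theta>)" and "prob_space \<nu>"
    using inv by (auto simp: invariant_measure_def)
  interpret prob_space \<nu> by fact
  let ?\<eta> = "subst_power \<theta> k"
  let ?good = "balanced_parse ?\<eta> (language \<theta>) K e"
  define c where "c = 2 * real (card (\<Union>b. set_pmf (?\<eta> b)))"
  let ?bd = "\<lambda>n. c * exp (- (e\<^sup>2 / 2 * (real n / real K - 1)))"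
  let ?A = "\<lambda>n. {x \<in> space \<nu>. prefix_seq x n \<in> {w. \<not> ?good w}}"
  have meas: "?A n \<in> sets \<nu>" for n
    using measurable_sets[OF measurable_prefix_seq[OF sets, of n], of "{w. \<not> ?good w}"]
    by (simp add: vimage_def Int_def conj_commute)
  have bound: "measure \<nu> (?A n) \<le> ?bd n" for n
  proof -
    obtain p where p: "\<And>A. measure \<nu> {x \<in> space \<nu>. prefix_seq x n \<in> A} = measure_pmf.prob p A"
      "set_pmf p \<subseteq> {v \<in> language \<theta>. length v = n}"
      using ex_prefix_pmf[OF inv] by blast
    have "bind_pmf p (\<lambda>v. map_pmf (take n) (subst_iter \<theta> k v)) = p"
      by (rule prefix_pmf_invariant_iter[OF rs _ prefix_pmf_invariant[OF rs inv p]]) (use p(2) in blast)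
    then have "emeasure (measure_pmf p) {w. \<not> ?good w}
        = emeasure (measure_pmf (bind_pmf p (\<lambda>v. map_pmf (take n) (subst_word ?\<eta> v)))) {w. \<not> ?good w}"
      by (simp only: subst_iter_eq_subst_word)
    also have "\<dots>
        = (\<integral>\<^sup>+ v. emeasure (measure_pmf (subst_word ?\<eta> v)) {w. \<not> ?good (take n w)} \<partial>measure_pmf p)"
      by (simp only: emeasure_bind_pmf emeasure_map_pmf vimage_Collect_eq)
    also have "\<dots> \<le> (\<integral>\<^sup>+ v. ennreal (?bd n) \<partial>measure_pmf p)"
    proof (rule nn_integral_mono_AE, unfold AE_measure_pmf_iff, rule ballI)
      fix v assume "v \<in> set_pmf p"
      with p(2) have v: "v \<in> language \<theta>" "n \<le> length v" by auto
      have "measure_pmf.prob (subst_word ?\<eta> v) {w. \<not> ?good (take n w)} \<le> ?bd n"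
        unfolding c_def
      proof (rule unbalanced_parse_prob)
        show "length w = iter_length \<theta> k [b]" if "w \<in> set_pmf (?\<eta> b)" for b w
          using that length_subst_iter[OF comp] by (simp add: subst_power_def)
      qed (use v K \<open>0 < e\<close> random_substitution_power[OF rs] language_take in auto)
      then show "emeasure (measure_pmf (subst_word ?\<eta> v)) {w. \<not> ?good (take n w)} \<le> ennreal (?bd n)"
        unfolding measure_pmf.emeasure_eq_measure by (rule ennreal_leI)
    qed
    also have "\<dots> = ennreal (?bd n)" by simp
    finally show ?thesis
      unfolding p(1) by (simp add: measure_pmf.emeasure_eq_measure c_def)
  qed
  have "summable ?bd"
  proof -
    let ?q = "exp (- (e\<^sup>2 / 2 / real K))"
    have "?bd n = c * exp (e\<^sup>2 / 2) * ?q ^ n" for n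
    proof -
      have "- (e\<^sup>2 / 2 * (real n / real K - 1)) = e\<^sup>2 / 2 + real n * (- (e\<^sup>2 / 2 / real K))"
        by (simp add: right_diff_distrib)
      then show ?thesis by (simp only: exp_add exp_of_nat_mult mult.assoc)
    qed
    moreover have "summable (\<lambda>n. c * exp (e\<^sup>2 / 2) * ?q ^ n)"
      by (intro summable_mult summable_geometric) (use K \<open>0 < e\<close> in simp)
    ultimately show ?thesis by (simp only:)
  qed
  then have "summable (\<lambda>n. measure \<nu> (?A n))"
    by (rule summable_comparison_test[rotated]) (use bound in auto)
  then have "AE x in \<nu>. \<forall>\<^sub>F n in sequentially. x \<in> space \<nu> - ?A n"
    by (intro borel_cantelli_AE1 meas) (simp_all add: less_top[symmetric])
  then show ?thesis
    by eventually_elim (auto elim!: eventually_mono)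
qed



section \<open>Integrals against visit measures\<close>

text \<open>The integral of \<open>f\<close> against the visit measure of \<open>w\<close> translated by \<open>y\<close>. The translation makes the sum
  additive under concatenation.\<close>

definition visit_sum ::
    "real^'a::finite \<Rightarrow> real^'a \<Rightarrow> 'a \<Rightarrow> (real^'a \<Rightarrow> real) \<Rightarrow> real^'a \<Rightarrow> 'a list \<Rightarrow> real" where
  "visit_sum L R a f y w =
     (\<Sum>m<length w. of_bool (w ! m = a) * f (y + pf_proj L R (abelianization (take m w))))"

lemma visit_sum_Nil [simp]: "visit_sum L R a f y [] = 0"
  by (simp add: visit_sum_def)

lemma pf_proj_0 [simp]: "pf_proj L R 0 = 0"
  by (simp add: pf_proj_def)

lemma visit_sum_Cons:
  "visit_sum L R a f y (c # w)
     = of_bool (c = a) * f y + visit_sum L R a f (y + pf_proj L R (abelianization [c])) w"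
  unfolding visit_sum_def list.size add_0_right add_Suc_right
  by (subst sum.lessThan_Suc_shift)
    (simp add: abelianization_Cons[of c "take _ w"] linear_add[OF pf_proj_linear] add.assoc)

lemma visit_sum_append:
  "visit_sum L R a f y (u @ w)
     = visit_sum L R a f y u + visit_sum L R a f (y + pf_proj L R (abelianization u)) w"
proof (induction u arbitrary: y)
  case (Cons c u)
  have "pf_proj L R (abelianization (c # u))
      = pf_proj L R (abelianization [c]) + pf_proj L R (abelianization u)"
    by (subst abelianization_Cons) (rule linear_add[OF pf_proj_linear])
  then show ?case by (simp add: visit_sum_Cons Cons.IH add.assoc)
qed simp

lemma abs_visit_sum_le:
  assumes "\<And>x. \<bar>f x\<bar> \<le> B"
  shows "\<bar>visit_sum L R a f y w\<bar> \<le> B * real (length w)"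
proof -
  have "0 \<le> B" using assms[of 0] by linarith
  then have "\<bar>visit_sum L R a f y w\<bar> \<le> (\<Sum>m<length w. B)"
    unfolding visit_sum_def by (intro order_trans[OF sum_abs sum_mono]) (auto simp: assms)
  then show ?thesis by (simp add: mult.commute)
qed

lemma visit_sum_shift:
  assumes "\<And>m. \<bar>f (y + pf_proj L R (abelianization (take m w))) - f (pf_proj L R (abelianization (take m w)))\<bar> \<le> h"
  shows "\<bar>visit_sum L R a f y w - visit_sum L R a f 0 w\<bar> \<le> h * real (length w)"
proof -
  have "0 \<le> h" using assms[of 0] by linarith
  then have "\<bar>visit_sum L R a f y w - visit_sum L R a f 0 w\<bar> \<le> (\<Sum>m<length w. h)"
    unfolding visit_sum_def sum_subtractf[symmetric]
    by (intro order_trans[OF sum_abs sum_mono]) (auto simp: assms)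
  then show ?thesis by (simp add: mult.commute)
qed

text \<open>If all blocks start close to the origin, each of them may be moved there.\<close>

lemma visit_sum_concat:
  assumes "\<And>i. i \<le> length ws \<Longrightarrow> norm (y + pf_proj L R (abelianization (concat (take i ws)))) \<le> d"
    and "\<And>w m z. w \<in> set ws \<Longrightarrow> norm z \<le> d \<Longrightarrow>
           \<bar>f (z + pf_proj L R (abelianization (take m w))) - f (pf_proj L R (abelianization (take m w)))\<bar> \<le> h"
  shows "\<bar>visit_sum L R a f y (concat ws) - (\<Sum>w\<leftarrow>ws. visit_sum L R a f 0 w)\<bar>
           \<le> h * real (length (concat ws))"
  using assms
proof (induction ws arbitrary: y)
  case (Cons w ws)
  let ?y = "y + pf_proj L R (abelianization w)"
  have 1: "\<bar>visit_sum L R a f y w - visit_sum L R a f 0 w\<bar> \<le> h * real (length w)"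
  proof (rule visit_sum_shift)
    have "norm y \<le> d" using Cons.prems(1)[of 0] by simp
    then show "\<bar>f (y + pf_proj L R (abelianization (take m w))) - f (pf_proj L R (abelianization (take m w)))\<bar> \<le> h" for m
      by (rule Cons.prems(2)[rotated]) simp
  qed
  have 2: "\<bar>visit_sum L R a f ?y (concat ws) - (\<Sum>w\<leftarrow>ws. visit_sum L R a f 0 w)\<bar>
      \<le> h * real (length (concat ws))"
  proof (rule Cons.IH)
    show "norm (?y + pf_proj L R (abelianization (concat (take i ws)))) \<le> d" if "i \<le> length ws" for i
      using Cons.prems(1)[of "Suc i"] that by (simp add: linear_add[OF pf_proj_linear] add.assoc)
    show "\<bar>f (z + pf_proj L R (abelianization (take m w'))) - f (pf_proj L R (abelianization (take m w')))\<bar> \<le> h"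
      if "w' \<in> set ws" "norm z \<le> d" for w' m z
      using Cons.prems(2)[of w' z m] that by simp
  qed
  have "visit_sum L R a f y (concat (w # ws)) - (\<Sum>w\<leftarrow>w # ws. visit_sum L R a f 0 w)
      = (visit_sum L R a f y w - visit_sum L R a f 0 w)
        + (visit_sum L R a f ?y (concat ws) - (\<Sum>w\<leftarrow>ws. visit_sum L R a f 0 w))"
    by (simp only: concat.simps visit_sum_append list.map sum_list.Cons)
  moreover have "h * real (length (concat (w # ws))) = h * real (length w) + h * real (length (concat ws))"
    by (simp only: concat.simps length_append of_nat_add distrib_left)
  ultimately show ?case using 1 2 by linarith
qed simp

lemma integral_scale_measure:
  fixes f :: "'b \<Rightarrow> real"
  assumes "f \<in> borel_measurable M" "0 \<le> r"
  shows "(\<integral>x. f x \<partial>scale_measure (ennreal r) M) = r * (\<integral>x. f x \<partial>M)"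
proof -
  have "scale_measure (ennreal r) M = density M (\<lambda>_. ennreal r)"
  proof (rule measure_eqI)
    fix A assume "A \<in> sets (scale_measure (ennreal r) M)"
    then have "A \<in> sets M" by simp
    then show "emeasure (scale_measure (ennreal r) M) A = emeasure (density M (\<lambda>_. ennreal r)) A"
      by (simp add: emeasure_density nn_integral_cmult_indicator)
  qed simp
  then show ?thesis
    using assms by (simp add: integral_density)
qed

lemma integral_visit_measure:
  fixes f :: "real^'a::finite \<Rightarrow> real"
  assumes "f \<in> borel_measurable borel"
  shows "(\<integral>x. f x \<partial>visit_measure L R a w) = visit_sum L R a f 0 w"
proof -
  let ?S = "{m. m < length w \<and> w ! m = a}"
  have "(\<integral>x. f x \<partial>visit_measure L R a w)
      = (\<Sum>m\<in>?S. f (pf_proj L R (abelianization (take m w))))"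
    unfolding visit_measure_def
    by (subst integral_distr) (use assms in \<open>auto simp: lebesgue_integral_count_space_finite\<close>)
  also have "\<dots> = visit_sum L R a f 0 w"
    unfolding visit_sum_def
    by (rule sum.mono_neutral_cong_left) auto
  finally show ?thesis .
qed

text \<open>For a law of finite support the expected visit measure is the image of a finite measure on the pairs of
  a word and a position in it, and the integral becomes a finite double sum.\<close>

lemma integral_expected_visit_measure:
  fixes f :: "real^'a::finite \<Rightarrow> real"
  assumes f: "f \<in> borel_measurable borel" and fin: "finite (set_pmf p)"
  shows "(\<integral>x. f x \<partial>expected_measure p (visit_measure L R a))
           = (\<integral>w. visit_sum L R a f 0 w \<partial>measure_pmf p)"
proof -
  let ?S = "\<lambda>w. {m. m < length w \<and> w ! m = a}"
  let ?A = "SIGMA w:set_pmf p. ?S w"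
  let ?g = "\<lambda>(w, m). pf_proj L R (abelianization (take m w))"
  let ?Q = "point_measure ?A (\<lambda>x. ennreal (pmf p (fst x)))"
  have finA: "finite ?A" using fin by auto
  have meas: "?g \<in> measurable ?Q borel" by simp
  have "expected_measure p (visit_measure L R a) = distr ?Q borel ?g"
  proof (rule measure_eqI)
    show "sets (expected_measure p (visit_measure L R a)) = sets (distr ?Q borel ?g)"
      by (simp add: expected_measure_def sets.sigma_sets_eq[of borel, simplified])
    fix B assume "B \<in> sets (expected_measure p (visit_measure L R a))"
    then have B: "B \<in> sets borel"
      by (simp add: expected_measure_def sets.sigma_sets_eq[of borel, simplified])
    have "emeasure (expected_measure p (visit_measure L R a)) B
        = (\<Sum>w\<in>set_pmf p. emeasure (visit_measure L R a w) B * ennreal (pmf p w))"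
      by (subst emeasure_expected_measure)
        (auto simp: B visit_measure_def nn_integral_measure_pmf_finite[OF fin])
    also have "\<dots> = (\<Sum>w\<in>set_pmf p. \<Sum>m\<in>?S w. ennreal (pmf p w) * indicator B (?g (w, m)))"
      by (simp only: emeasure_visit_measure[OF B] sum_distrib_left mult.commute prod.case)
    also have "\<dots> = (\<Sum>x\<in>?A. ennreal (pmf p (fst x)) * indicator B (?g x))"
      by (subst sum.Sigma) (auto simp: fin split_beta)
    also have "\<dots> = (\<Sum>x\<in>?g -` B \<inter> ?A. ennreal (pmf p (fst x)))"
      by (rule sum.mono_neutral_cong_right) (auto simp: finA indicator_def)
    also have "\<dots> = emeasure (distr ?Q borel ?g) B"
      by (subst emeasure_distr[OF meas B])
        (simp add: space_point_measure emeasure_point_measure_finite[OF finA] split_beta)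
    finally show "emeasure (expected_measure p (visit_measure L R a)) B = emeasure (distr ?Q borel ?g) B" .
  qed
  then have "(\<integral>x. f x \<partial>expected_measure p (visit_measure L R a)) = (\<integral>x. f (?g x) \<partial>?Q)"
    by (simp only: integral_distr[OF meas f])
  also have "\<dots> = (\<Sum>x\<in>?A. pmf p (fst x) * f (?g x))"
    using lebesgue_integral_point_measure_finite[OF finA, of "\<lambda>x. pmf p (fst x)" "\<lambda>x. f (?g x)"]
    by (simp add: split_beta)
  also have "\<dots> = (\<Sum>w\<in>set_pmf p. \<Sum>m\<in>?S w. pmf p w * f (?g (w, m)))"
    by (subst sum.Sigma) (auto simp: fin split_beta)
  also have "\<dots> = (\<Sum>w\<in>set_pmf p. visit_sum L R a f 0 w * pmf p w)"
  proof (rule sum.cong[OF refl])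
    fix w
    have "visit_sum L R a f 0 w = (\<Sum>m\<in>?S w. f (?g (w, m)))"
      unfolding visit_sum_def by (rule sum.mono_neutral_cong_right) auto
    then show "(\<Sum>m\<in>?S w. pmf p w * f (?g (w, m))) = visit_sum L R a f 0 w * pmf p w"
      by (simp add: sum_distrib_left mult.commute)
  qed
  also have "\<dots> = (\<integral>w. visit_sum L R a f 0 w \<partial>measure_pmf p)"
    by (rule integral_measure_pmf_real[symmetric]) (auto simp: fin)
  finally show ?thesis .
qed

text \<open>The defining limit of the Rauzy measure for words of length one.\<close>

lemma rauzy_measure_letter_limit:
  assumes rs: "random_substitution \<theta>" and m: "rauzy_measure \<theta> L R a \<mu>"
    and f: "continuous_on UNIV f" "bounded (range f)"
  shows "(\<lambda>k. (\<integral>w. visit_sum L R a f 0 w \<partial>measure_pmf (subst_power \<theta> k b)) / real (iter_length \<theta> k [b]))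
           \<longlonglongrightarrow> (\<integral>x. f x \<partial>\<mu>)"
proof -
  have fb: "f \<in> borel_measurable borel" by (rule borel_measurable_continuous_onI[OF f(1)])
  have se: "sets (expected_measure p (visit_measure L R a)) = sets borel" for p
    by (simp add: expected_measure_def sets.sigma_sets_eq[of borel, simplified])
  have fin: "finite (set_pmf (subst_power \<theta> k b))" for k
    using random_substitution_power[OF rs, of k] by (simp add: random_substitution_def)
  have "(\<integral>x. f x \<partial>scale_measure (ennreal (1 / real (iter_length \<theta> k [b])))
          (expected_measure (subst_iter \<theta> k [b]) (visit_measure L R a)))
      = (\<integral>w. visit_sum L R a f 0 w \<partial>measure_pmf (subst_power \<theta> k b)) / real (iter_length \<theta> k [b])" for k
    using integral_expected_visit_measure[OF fb fin]
    by (subst integral_scale_measure)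
      (simp_all add: fb measurable_cong_sets[OF se refl] subst_power_def)
  moreover have "(\<lambda>k. \<integral>x. f x \<partial>scale_measure (ennreal (1 / real (iter_length \<theta> k [b])))
          (expected_measure (subst_iter \<theta> k [b]) (visit_measure L R a))) \<longlonglongrightarrow> (\<integral>x. f x \<partial>\<mu>)"
    using m f unfolding rauzy_measure_def weakly_converges_def by (meson list.discI)
  ultimately show ?thesis by simp
qed

section \<open>Convergence along balanced sequences\<close>

text \<open>Every function on blocks is a combination of the indicators of the finitely many blocks. So balance of the
  individual block counts controls the sums of all functions at once.\<close>

lemma block_sum_deviation:
  fixes \<theta> :: "'a::finite \<Rightarrow> 'a list pmf"
  assumes rs: "random_substitution \<theta>" and ws: "ws \<in> set_pmf (subst_blocks \<theta> v)"
  shows "(\<Sum>w\<leftarrow>ws. G w) - (\<Sum>b\<leftarrow>v. \<integral>w. G w \<partial>measure_pmf (\<theta> b))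
           = (\<Sum>u\<in>(\<Union>b. set_pmf (\<theta> b)). G u * block_deviation \<theta> u v ws)"
  using ws unfolding subst_blocks_support
proof (induction rule: list_all2_induct)
  case (Cons w ws b v)
  let ?U = "\<Union>b. set_pmf (\<theta> b)"
  have U: "finite ?U" by (rule finite_block_alphabet[OF rs])
  have "w \<in> ?U" using Cons by auto
  then have "G w = (\<Sum>u\<in>?U. G u * of_bool (w = u))"
    using U by (simp add: if_distrib of_bool_def cong: if_cong)
  moreover have "(\<integral>w. G w \<partial>measure_pmf (\<theta> b)) = (\<Sum>u\<in>?U. G u * pmf (\<theta> b) u)"
    by (rule integral_measure_pmf_real[OF U]) auto
  ultimately have "G w - (\<integral>w. G w \<partial>measure_pmf (\<theta> b)) = (\<Sum>u\<in>?U. G u * (of_bool (w = u) - pmf (\<theta> b) u))"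
    by (simp only: right_diff_distrib sum_subtractf)
  with Cons.IH show ?case
    by (simp add: distrib_left sum.distrib)
qed simp

text \<open>Here \<open>\<theta>\<close> stands for a high power of the random substitution and \<open>I\<close> for the integral of \<open>f\<close>
  against the Rauzy measure. The error has four sources: moving the blocks to the origin (\<open>h\<close>), the
  distance of the letter expectations from their limit (\<open>h\<close> again), the deviation of the block frequencies
  (\<open>e\<close>), and the incomplete block at the end (\<open>K\<close>).\<close>

lemma balanced_parse_visit_sum:
  fixes \<theta> :: "'a::finite \<Rightarrow> 'a list pmf" and f :: "real^'a \<Rightarrow> real"
  assumes rs: "random_substitution \<theta>"
    and len: "\<And>b w. w \<in> set_pmf (\<theta> b) \<Longrightarrow> length w = len b" "\<And>b. len b \<le> K"
    and f: "\<And>x. \<bar>f x\<bar> \<le> B"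
    and "0 \<le> e"
    and shift: "\<And>b u m z. u \<in> set_pmf (\<theta> b) \<Longrightarrow> norm z \<le> d \<Longrightarrow>
           \<bar>f (z + pf_proj L R (abelianization (take m u))) - f (pf_proj L R (abelianization (take m u)))\<bar> \<le> h"
    and offset: "\<And>v u. v \<in> Lang \<Longrightarrow> u \<in> set_pmf (subst_word \<theta> v) \<Longrightarrow> norm (pf_proj L R (abelianization u)) \<le> d"
    and Lang: "\<And>v i. v \<in> Lang \<Longrightarrow> take i v \<in> Lang"
    and mean: "\<And>b. \<bar>(\<integral>w. visit_sum L R a f 0 w \<partial>measure_pmf (\<theta> b)) - I * real (len b)\<bar> \<le> h * real (len b)"
    and w: "balanced_parse \<theta> Lang K e w"
  shows "\<bar>visit_sum L R a f 0 w - I * real (length w)\<bar>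
           \<le> (2 * h + e * (real (card (\<Union>b. set_pmf (\<theta> b))) * B * real K)) * real (length w) + (B + \<bar>I\<bar>) * real K"
proof -
  obtain v ws r where split: "w = concat ws @ r" and r: "length r \<le> K" and v: "v \<in> Lang"
    and ws: "ws \<in> set_pmf (subst_blocks \<theta> v)" and bal: "balanced_blocks \<theta> e v ws"
    using w unfolding balanced_parse_def by blast
  have all2: "list_all2 (\<lambda>w a. w \<in> set_pmf (\<theta> a)) ws v"
    using ws by (simp only: subst_blocks_support)
  let ?U = "\<Union>b. set_pmf (\<theta> b)"
  let ?G = "visit_sum L R a f 0"
  let ?n = "real (length (concat ws))"
  have B: "0 \<le> B" using f[of 0] by linarith
  have pos: "1 \<le> length u" if "u \<in> set_pmf (\<theta> b)" for u b
  proof -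
    have "u \<noteq> []" using that rs by (auto simp: random_substitution_def)
    then show ?thesis by (simp add: Suc_le_eq)
  qed
  have h: "0 \<le> h"
  proof -
    obtain u where u: "u \<in> set_pmf (\<theta> a)" by (metis ex_in_conv set_pmf_not_empty)
    have "0 < real (len a)" using pos[OF u] len(1)[OF u] by simp
    moreover have "0 \<le> h * real (len a)" using mean[of a] by linarith
    ultimately show ?thesis by (simp add: zero_le_mult_iff)
  qed
  have len_concat: "length (concat ws) = sum_list (map len v)" and len_v: "length v \<le> length (concat ws)"
  proof -
    show "length (concat ws) = sum_list (map len v)"
      using all2
    proof (induction rule: list_all2_induct)
      case (Cons x xs y ys)
      then show ?case using len(1)[of x y] by simp
    qed simp
    show "length v \<le> length (concat ws)"
      using all2
    proof (induction rule: list_all2_induct)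
      case (Cons x xs y ys)
      then show ?case using pos[of x y] by simp
    qed simp
  qed
  have 1: "\<bar>visit_sum L R a f 0 (concat ws) - (\<Sum>w\<leftarrow>ws. ?G w)\<bar> \<le> h * ?n"
  proof (rule visit_sum_concat)
    fix i assume "i \<le> length ws"
    have "take i ws \<in> set_pmf (subst_blocks \<theta> (take i v))"
      using all2 by (simp only: subst_blocks_support list_all2_takeI)
    then have "concat (take i ws) \<in> set_pmf (subst_word \<theta> (take i v))"
      by (simp only: subst_word_blocks set_map_pmf imageI)
    then show "norm (0 + pf_proj L R (abelianization (concat (take i ws)))) \<le> d"
      using offset[OF Lang[OF v]] by simp
  next
    fix u m and z :: "real^'a" assume u: "u \<in> set ws" and z: "norm z \<le> d"
    from u obtain i where "i < length ws" "u = ws ! i" by (auto simp: in_set_conv_nth)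
    then have "u \<in> set_pmf (\<theta> (v ! i))" using all2 by (auto simp: list_all2_conv_all_nth)
    then show "\<bar>f (z + pf_proj L R (abelianization (take m u))) - f (pf_proj L R (abelianization (take m u)))\<bar> \<le> h"
      using z by (rule shift)
  qed
  have "\<bar>(\<Sum>w\<leftarrow>ws. ?G w) - (\<Sum>b\<leftarrow>v. \<integral>w. ?G w \<partial>measure_pmf (\<theta> b))\<bar>
      \<le> (\<Sum>u\<in>?U. (B * real K) * (e * real (length v)))"
    unfolding block_sum_deviation[OF rs ws]
  proof (rule order_trans[OF sum_abs], rule sum_mono, unfold abs_mult, rule mult_mono)
    fix u assume u: "u \<in> ?U"
    then have "length u \<le> K" using len by fastforce
    then show "\<bar>?G u\<bar> \<le> B * real K"
      using abs_visit_sum_le[where f = f and B = B and L = L and R = R and a = a and y = 0 and w = u, OF f] mult_left_mono[OF _ B, of "real (length u)" "real K"] by linarith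
    show "\<bar>block_deviation \<theta> u v ws\<bar> \<le> e * real (length v)"
      using bal u unfolding balanced_blocks_def by blast
  qed (use B in auto)
  also have "\<dots> = e * (real (card ?U) * B * real K) * real (length v)"
    by simp
  also have "\<dots> \<le> e * (real (card ?U) * B * real K) * ?n"
    using len_v B \<open>0 \<le> e\<close> by (intro mult_left_mono) auto
  finally have 2: "\<bar>(\<Sum>w\<leftarrow>ws. ?G w) - (\<Sum>b\<leftarrow>v. \<integral>w. ?G w \<partial>measure_pmf (\<theta> b))\<bar>
      \<le> e * (real (card ?U) * B * real K) * ?n" .
  have "\<bar>(\<Sum>b\<leftarrow>x. \<integral>w. ?G w \<partial>measure_pmf (\<theta> b)) - I * real (sum_list (map len x))\<bar>
      \<le> h * real (sum_list (map len x))" for x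
  proof (induction x)
    case (Cons b x)
    then show ?case using mean[of b] by (simp add: distrib_left)
  qed simp
  then have 3: "\<bar>(\<Sum>b\<leftarrow>v. \<integral>w. ?G w \<partial>measure_pmf (\<theta> b)) - I * ?n\<bar> \<le> h * ?n"
    unfolding len_concat .
  have 4: "\<bar>visit_sum L R a f (0 + pf_proj L R (abelianization (concat ws))) r\<bar> \<le> B * real K"
    using abs_visit_sum_le[where f = f and B = B and L = L and R = R and a = a
          and y = "0 + pf_proj L R (abelianization (concat ws))" and w = r, OF f]
      mult_left_mono[OF _ B, of "real (length r)" "real K"] r by linarith
  have 5: "\<bar>I * real (length r)\<bar> \<le> \<bar>I\<bar> * real K"
    using r by (simp add: abs_mult mult_left_mono)
  let ?c = "2 * h + e * (real (card ?U) * B * real K)"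
  have "visit_sum L R a f 0 w - I * real (length w)
      = (visit_sum L R a f 0 (concat ws) - (\<Sum>w\<leftarrow>ws. ?G w))
        + ((\<Sum>w\<leftarrow>ws. ?G w) - (\<Sum>b\<leftarrow>v. \<integral>w. ?G w \<partial>measure_pmf (\<theta> b)))
        + ((\<Sum>b\<leftarrow>v. \<integral>w. ?G w \<partial>measure_pmf (\<theta> b)) - I * ?n)
        + visit_sum L R a f (0 + pf_proj L R (abelianization (concat ws))) r - I * real (length r)"
    unfolding split visit_sum_append length_append of_nat_add distrib_left by linarith
  then have "\<bar>visit_sum L R a f 0 w - I * real (length w)\<bar>
      \<le> h * ?n + e * (real (card ?U) * B * real K) * ?n + h * ?n + B * real K + \<bar>I\<bar> * real K"
    using 1 2 3 4 5 by linarith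
  also have "\<dots> = ?c * ?n + (B + \<bar>I\<bar>) * real K"
    by (simp only: distrib_right mult_2)
  also have "?c * ?n \<le> ?c * real (length w)"
  proof (rule mult_left_mono)
    show "?n \<le> real (length w)" unfolding split length_append by linarith
    show "0 \<le> ?c"
      using h B \<open>0 \<le> e\<close> by simp
  qed
  finally show ?thesis by simp
qed



definition max_iter_length :: "('a::finite \<Rightarrow> 'a list pmf) \<Rightarrow> nat \<Rightarrow> nat" where
  "max_iter_length \<theta> k = Max (range (\<lambda>b. iter_length \<theta> k [b]))"

lemma iter_length_le_max: "iter_length \<theta> k [b] \<le> max_iter_length \<theta> k"
  unfolding max_iter_length_def by (rule Max_ge) auto

lemma iter_length_pos:
  assumes "random_substitution \<theta>" "compatible \<theta>"
  shows "0 < iter_length \<theta> k [b]"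
proof -
  obtain u where u: "u \<in> set_pmf (subst_power \<theta> k b)" by (metis ex_in_conv set_pmf_not_empty)
  then have "u \<noteq> []"
    using random_substitution_power[OF assms(1), of k] by (auto simp: random_substitution_def)
  moreover have "length u = iter_length \<theta> k [b]"
    using u length_subst_iter[OF assms(2)] by (simp add: subst_power_def)
  ultimately show ?thesis by (metis length_greater_0_conv)
qed

text \<open>Given the accuracy, the power \<open>k\<close> is chosen first, to make the starting points of the blocks small and the
  letter expectations accurate; then the tolerance \<open>1 / Suc j\<close>, which may depend on the number and the
  lengths of the blocks of that power; and \<open>n\<close> last.\<close>

lemma weak_limit_of_balanced_parses:
  fixes \<theta> :: "'a::finite \<Rightarrow> 'a list pmf"
  assumes rs: "random_substitution \<theta>" and comp: "compatible \<theta>"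
    and irr: "irreducible_pisot \<theta>" and ev: "pf_eigenvectors \<theta> L R"
    and rauzy: "rauzy_measure \<theta> L R a \<mu>"
    and good: "\<And>k j. \<forall>\<^sub>F n in sequentially. balanced_parse (subst_power \<theta> k) (language \<theta>)
                 (max_iter_length \<theta> k) (1 / real (Suc j)) (prefix_seq x n)"
  shows "weakly_converges
           (\<lambda>n. scale_measure (ennreal (1 / real n)) (visit_measure L R a (prefix_seq x n))) \<mu>"
  unfolding weakly_converges_def
proof (intro allI impI)
  fix f :: "real^'a \<Rightarrow> real"
  assume f: "continuous_on UNIV f" "bounded (range f)"
  have fb: "f \<in> borel_measurable borel" by (rule borel_measurable_continuous_onI[OF f(1)])
  obtain B where B: "\<And>x. \<bar>f x\<bar> \<le> B" using f(2) by (auto simp: bounded_iff)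
  let ?P = "\<lambda>u. pf_proj L R (abelianization u)"
  let ?S = "\<lambda>n. visit_sum L R a f 0 (prefix_seq x n)"
  define I where "I = (\<integral>x. f x \<partial>\<mu>)"
  obtain C where C: "0 < C" "\<And>u. u \<in> language \<theta> \<Longrightarrow> norm (?P u) \<le> C"
    using language_projection_bounded[OF rs comp irr ev] by blast
  obtain c :: "nat \<Rightarrow> real" where c: "summable c" "\<And>k. 0 \<le> c k"
    and contr: "\<And>k x. L \<bullet> x = 0 \<Longrightarrow> norm (((*v) (subst_matrix \<theta>) ^^ k) x) \<le> c k * norm x"
    using contraction_on_hyperplane[OF irr ev] by blast
  have LR: "L \<bullet> R = 1" using ev by (simp add: pf_eigenvectors_def)
  have "(\<lambda>n. ?S n / real n) \<longlonglongrightarrow> I"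
  proof (rule tendstoI)
    fix \<epsilon> :: real assume \<epsilon>: "0 < \<epsilon>"
    \<comment> \<open>The error consists of \<open>2 * h\<close>, the frequency term and the boundary term, each at most \<open>\<epsilon> / 4\<close>.\<close>
    define h where "h = \<epsilon> / 8"
    have h: "0 < h" using \<epsilon> by (simp add: h_def)
    have "uniformly_continuous_on (cball 0 (C + 1)) f"
      by (rule compact_uniformly_continuous[OF continuous_on_subset[OF f(1)]]) auto
    then obtain d0 where d0: "0 < d0" "\<And>p q. p \<in> cball 0 (C + 1) \<Longrightarrow> q \<in> cball 0 (C + 1) \<Longrightarrow>
        dist q p < d0 \<Longrightarrow> dist (f q) (f p) < h"
      using h unfolding uniformly_continuous_on_def by blast
    \<comment> \<open>The bound 1 keeps shifted points in the ball where \<open>f\<close> is uniformly continuous.\<close>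
    define d where "d = min 1 (d0 / 2)"
    have d: "0 < d" "d \<le> 1" "d < d0" using d0(1) by (auto simp: d_def)
    have close: "\<bar>f (z + ?P u) - f (?P u)\<bar> \<le> h" if "u \<in> language \<theta>" "norm z \<le> d" for u z
    proof -
      have "norm (z + ?P u) \<le> C + 1"
        using norm_triangle_ineq[of z "?P u"] C(2)[OF that(1)] that(2) d(2) by linarith
      moreover have "norm (?P u) \<le> C + 1" using C(2)[OF that(1)] by linarith
      moreover have "dist (z + ?P u) (?P u) < d0" using that(2) d(3) by (simp add: dist_norm)
      ultimately have "dist (f (z + ?P u)) (f (?P u)) < h" by (intro d0(2)) auto
      then show ?thesis by (simp add: dist_real_def)
    qed
    let ?X = "\<lambda>k b. (\<integral>w. visit_sum L R a f 0 w \<partial>measure_pmf (subst_power \<theta> k b))"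
    have "(\<lambda>k. c k * C) \<longlonglongrightarrow> 0"
      by (rule tendsto_mult_left_zero[OF summable_LIMSEQ_zero[OF c(1)]])
    then have ev1: "\<forall>\<^sub>F k in sequentially. c k * C < d"
      using d(1) by (rule order_tendstoD)
    have ev2: "\<forall>\<^sub>F k in sequentially. \<forall>b. dist (?X k b / real (iter_length \<theta> k [b])) I < h"
      unfolding I_def
      by (intro eventually_all_finite tendstoD[OF rauzy_measure_letter_limit[OF rs rauzy f]] h)
    obtain k where k1: "c k * C < d"
      and k2: "\<And>b. dist (?X k b / real (iter_length \<theta> k [b])) I < h"
      using eventually_happens'[OF sequentially_bot eventually_conj[OF ev1 ev2]] by blast
    let ?\<eta> = "subst_power \<theta> k"
    let ?len = "\<lambda>b. iter_length \<theta> k [b]"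
    let ?K = "max_iter_length \<theta> k"
    define Q where "Q = real (card (\<Union>b. set_pmf (?\<eta> b))) * B * real ?K"
    have B0: "0 \<le> B" using B[of 0] by linarith
    have Q: "0 \<le> Q" using B0 by (simp add: Q_def)
    obtain j where j: "inverse (real (Suc j)) < \<epsilon> / 4 / (Q + 1)"
      using reals_Archimedean[of "\<epsilon> / 4 / (Q + 1)"] \<epsilon> Q by auto
    let ?e = "1 / real (Suc j)"
    have eQ: "?e * Q \<le> \<epsilon> / 4"
    proof -
      have "?e * Q \<le> ?e * (Q + 1)" by (intro mult_left_mono) auto
      also have "\<dots> \<le> \<epsilon> / 4 / (Q + 1) * (Q + 1)"
        by (rule mult_right_mono) (use j Q in \<open>auto simp: inverse_eq_divide\<close>)
      also have "\<dots> = \<epsilon> / 4"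
        by (rule iffD1[OF nonzero_eq_divide_eq]) (use Q in auto)
      finally show ?thesis .
    qed
    have est: "\<bar>?S n - I * real n\<bar> \<le> (2 * h + ?e * Q) * real n + (B + \<bar>I\<bar>) * real ?K"
      if parse: "balanced_parse ?\<eta> (language \<theta>) ?K ?e (prefix_seq x n)" for n
    proof -
      have "\<bar>?S n - I * real (length (prefix_seq x n))\<bar>
          \<le> (2 * h + ?e * Q) * real (length (prefix_seq x n)) + (B + \<bar>I\<bar>) * real ?K"
        unfolding Q_def
      proof (rule balanced_parse_visit_sum[where d = d and len = ?len and Lang = "language \<theta>"])
        show "random_substitution ?\<eta>" by (rule random_substitution_power[OF rs])
        show "length w = ?len b" if "w \<in> set_pmf (?\<eta> b)" for b w
          using that length_subst_iter[OF comp] by (simp add: subst_power_def)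
        show "\<bar>f (z + ?P (take m u)) - f (?P (take m u))\<bar> \<le> h"
          if "u \<in> set_pmf (?\<eta> b)" "norm z \<le> d" for b u m z
          by (rule close[OF language_take[OF subst_power_language[OF that(1)]] that(2)])
        show "norm (?P u) \<le> d" if "v \<in> language \<theta>" "u \<in> set_pmf (subst_word ?\<eta> v)" for v u
        proof -
          have "?P u = ((*v) (subst_matrix \<theta>) ^^ k) (?P v)"
            using that(2) abelianization_subst_iter[OF comp, of u k v]
            by (simp add: subst_iter_eq_subst_word pf_proj_matrix_iter[OF ev])
          then have "norm (?P u) \<le> c k * norm (?P v)"
            using contr[OF pf_proj_hyperplane[OF LR]] by simp
          also have "\<dots> \<le> c k * C" by (intro mult_left_mono C(2) that(1) c(2))
          finally show ?thesis using k1 by linarith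
        qed
        show "\<bar>?X k b - I * real (?len b)\<bar> \<le> h * real (?len b)" for b
        proof -
          have len: "0 < real (?len b)" using iter_length_pos[OF rs comp] by simp
          have "?X k b - I * real (?len b) = (?X k b / real (?len b) - I) * real (?len b)"
            using len by (simp add: left_diff_distrib)
          also have "\<bar>\<dots>\<bar> = \<bar>?X k b / real (?len b) - I\<bar> * real (?len b)"
            by (simp add: abs_mult)
          also have "\<dots> \<le> h * real (?len b)"
            using k2[of b] by (intro mult_right_mono) (auto simp: dist_real_def)
          finally show ?thesis .
        qed
      qed (use parse B iter_length_le_max language_take in auto)
      then show ?thesis by (simp add: prefix_seq_def)
    qed
    let ?D = "(B + \<bar>I\<bar>) * real ?K"
    have "(\<lambda>n. ?D / real n) \<longlonglongrightarrow> 0" by (rule lim_const_over_n)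
    then have "\<forall>\<^sub>F n in sequentially. ?D / real n < \<epsilon> / 4"
      by (rule order_tendstoD) (use \<epsilon> in simp)
    with good[of k j] eventually_gt_at_top[of 0]
    show "\<forall>\<^sub>F n in sequentially. dist (?S n / real n) I < \<epsilon>"
    proof eventually_elim
      case (elim n)
      have n: "0 < real n" using elim(2) by simp
      have "dist (?S n / real n) I = \<bar>?S n - I * real n\<bar> / real n"
      proof -
        have "?S n / real n - I = (?S n - I * real n) / real n"
          using n by (simp add: diff_divide_distrib)
        then show ?thesis by (simp only: dist_real_def abs_divide abs_of_nat)
      qed
      also have "\<dots> \<le> ((2 * h + ?e * Q) * real n + ?D) / real n"
        using est[OF elim(1)] n by (intro divide_right_mono) auto
      also have "\<dots> = 2 * h + ?e * Q + ?D / real n"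
        using n by (simp add: add_divide_distrib)
      also have "\<dots> < \<epsilon>" using eQ elim(3) \<epsilon> unfolding h_def by linarith
      finally show ?case .
    qed
  qed
  moreover have "(\<integral>y. f y \<partial>scale_measure (ennreal (1 / real n)) (visit_measure L R a (prefix_seq x n)))
      = ?S n / real n" for n
  proof -
    have "f \<in> borel_measurable (visit_measure L R a (prefix_seq x n))"
      using fb by (simp add: visit_measure_def)
    then show ?thesis
      by (simp add: integral_scale_measure integral_visit_measure[OF fb])
  qed
  ultimately show "(\<lambda>n. \<integral>y. f y \<partial>scale_measure (ennreal (1 / real n))
      (visit_measure L R a (prefix_seq x n))) \<longlonglongrightarrow> (\<integral>y. f y \<partial>\<mu>)"
    by (simp add: I_def)
qed

theorem proposition5p11:
  fixes \<theta> :: "'a::finite \<Rightarrow> 'a list pmf"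
    and L R :: "real^'a"
    and \<mu>bar :: "'a \<Rightarrow> (real^'a) measure"
    and \<nu> :: "(nat \<Rightarrow> 'a) measure"
  assumes "random_substitution \<theta>"
    and "compatible \<theta>"
    and "irreducible_pisot \<theta>"
    and "pf_eigenvectors \<theta> L R"
    and "\<And>a. rauzy_measure \<theta> L R a (\<mu>bar a)"
    and "invariant_measure \<theta> \<nu>"
  shows "AE w in \<nu>. \<forall>a. weakly_converges
           (\<lambda>n. scale_measure (ennreal (1 / real n)) (visit_measure L R a (prefix_seq w n)))
           (\<mu>bar a)"
proof -
  have "AE w in \<nu>. \<forall>k j. \<forall>\<^sub>F n in sequentially. balanced_parse (subst_power \<theta> k) (language \<theta>)
          (max_iter_length \<theta> k) (1 / real (Suc j)) (prefix_seq w n)"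
    unfolding AE_all_countable
  proof (intro allI AE_balanced_parse[OF assms(1,2,6)])
    show "0 < max_iter_length \<theta> k" for k
      using iter_length_pos[OF assms(1,2)] iter_length_le_max less_le_trans by blast
  qed (auto simp: iter_length_le_max)
  then show ?thesis
  proof eventually_elim
    case (elim w)
    then show ?case
      using weak_limit_of_balanced_parses[OF assms(1-4) assms(5)] by blast
  qed
qed

end
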